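(* Let $1\le p<\infty$ and $0<q<\infty$. There exist constants $0<k\le K<\infty$ depending only on $p$ and $q$ such that the following holds for every compact interval $J=[c,d]$, $c<d$, every measurable $v:J\to[0,\infty]$ that is regular on $J$ (that is, for some $\delta>0$, $v(t)\in[\delta,\infty]$ for almost every $t\in J$) and every integrable $w\ge0$ on $J$. Let $L_{p,q}(v,w;J)$ be the optimal constant $L$ in $$\|H_Jh\|_{L^q(w;J)}\le L\,\|h\|_{L^p(v;J)},\qquad h\ge0 .$$ (i) If $p\le q$, then with $A=\sup_{x\in J}\Phi_{p,v;J}(x)W_J(x)^{1/q}$ one has $kA\le L_{p,q}(v,w;J)\le KA$. (ii) If $0<q<p<\infty$ and $\frac1r=\frac1q-\frac1p$, then with $$A=\left(\int_JW_J(x)^{r/q}\,d\!\left(\Phi_{p,v;J}(x)^r\right)\right)^{1/r}$$ one has $kA\le L_{p,q}(v,w;J)\le KA$. Both equivalences hold in the extended sense (in $[0,\infty]$). In particular, for $p=1>q$ the integral in (ii) contains the boundary contribution $W_J(c)^{r/q}\,\Phi_{1,v;J}(c)^r$ of the atom of the Stieltjes measure at $c$.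
   Context: $H_Jh(x)=\int_c^xh(t)\,dt$ and $W_J(x)=\int_x^dw(t)\,dt$ for $x\in J$. All functions are nonnegative and measurable. Weighted functionals: $\|h\|_{L^s(w;J)}=\left(\int_Jh(t)^s\odot w(t)\,dt\right)^{1/s}$, where for $a,b\in[0,\infty]$ the product $a\odot b$ is $0$ if $a=0$ or $b=0$, $ab$ if both are positive and finite, and $\infty$ otherwise (so finite-norm inputs vanish a.e. where $v=\infty$). Profiles: on $\{v=\infty\}$ put $1/v=0$ and $v^{1-p'}=0$, where $p'=p/(p-1)$. For $1<p<\infty$, $\Phi_{p,v;J}(x)=\left(\int_c^xv(t)^{1-p'}dt\right)^{1/p'}$, $c\le x\le d$. For $p=1$, with $F_{v,J}(x)=\operatorname{ess\,sup}_{c<t<x}\frac1{v(t)}$ for $c<x\le d$, put $\Phi_{1,v;J}(x)=\lim_{y\downarrow x}F_{v,J}(y)$ for $c\le x<d$ and $\Phi_{1,v;J}(d)=F_{v,J}(d)$. Stieltjes convention: for $G:[c,d]\to[0,\infty)$ nondecreasing and right-continuous, $dG$ is the Borel measure on $[c,d]$ with $dG([c,x])=G(x)$ for all $x\in[c,d]$ ($G$ extended by zero to the left of $c$); in particular $dG(\{c\})=G(c)$. *)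

theory Defs
  imports "HOL-Analysis.Analysis" "HOL-Probability.Essential_Supremum"
begin

text \<open>
  Weights and functions take values in \<^typ>\<open>ennreal\<close>, that is, in $[0,\infty]$. Multiplication
  there has $0 \cdot \infty = \infty \cdot 0 = 0$, so \<open>*\<close> is the product written $a \odot b$ in
  the mathematics, and \<open>1 / \<infinity> = 0\<close>, \<open>1 / 0 = \<infinity>\<close>.
\<close>

text \<open>
  Real powers of extended nonnegative numbers: $\infty^a$ is $\infty$ for $a > 0$ and $0$ for
  $a < 0$, and $0^a = \infty$ for $a < 0$. The library has \<open>powr\<close> only for finite bases, and
  there \<open>0 powr a = 0\<close> for every \<open>a\<close>.
\<close>
definition epowr :: "ennreal \<Rightarrow> real \<Rightarrow> ennreal" where
  "epowr x a =
     (if a = 0 then 1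
      else if x = \<infinity> then (if a > 0 then \<infinity> else 0)
      else if x = 0 then (if a > 0 then 0 else \<infinity>)
      else ennreal (enn2real x powr a))"

lemma epowr_ennreal: "0 < x \<Longrightarrow> epowr (ennreal x) a = ennreal (x powr a)"
  by (simp add: epowr_def ennreal_eq_0_iff)

text \<open>The interval $J = [c,d]$ is passed as its endpoints.\<close>

definition wnorm :: "real \<Rightarrow> (real \<Rightarrow> ennreal) \<Rightarrow> real \<Rightarrow> real \<Rightarrow> (real \<Rightarrow> ennreal) \<Rightarrow> ennreal" where
  "wnorm s w c d h = epowr (\<integral>\<^sup>+t\<in>{c..d}. (epowr (h t) s * w t) \<partial>lebesgue) (1 / s)"

definition hardy :: "real \<Rightarrow> (real \<Rightarrow> ennreal) \<Rightarrow> real \<Rightarrow> ennreal" where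
  "hardy c h x = (\<integral>\<^sup>+t\<in>{c..x}. h t \<partial>lebesgue)"

definition tail_int :: "real \<Rightarrow> (real \<Rightarrow> ennreal) \<Rightarrow> real \<Rightarrow> ennreal" where
  "tail_int d w x = (\<integral>\<^sup>+t\<in>{x..d}. w t \<partial>lebesgue)"

definition regular_weight :: "(real \<Rightarrow> ennreal) \<Rightarrow> real \<Rightarrow> real \<Rightarrow> bool" where
  "regular_weight v c d \<longleftrightarrow> (\<exists>\<delta>::real. \<delta> > 0 \<and> (AE t in lebesgue_on {c..d}. ennreal \<delta> \<le> v t))"

text \<open>
  The optimal constant is an infimum in $[0,\infty]$. An \<open>h\<close> of infinite norm does not affect it:
  such an \<open>h\<close> can only exclude \<open>L = 0\<close> from the set, never a positive \<open>L\<close>.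
\<close>
definition opt_const ::
  "real \<Rightarrow> real \<Rightarrow> (real \<Rightarrow> ennreal) \<Rightarrow> (real \<Rightarrow> ennreal) \<Rightarrow> real \<Rightarrow> real \<Rightarrow> ennreal" where
  "opt_const p q v w c d =
     Inf {L. \<forall>h \<in> borel_measurable (lebesgue_on {c..d}).
               wnorm q w c d (hardy c h) \<le> L * wnorm p v c d h}"

definition conj_exp :: "real \<Rightarrow> real" where
  "conj_exp p = p / (p - 1)"

definition ess_profile :: "(real \<Rightarrow> ennreal) \<Rightarrow> real \<Rightarrow> real \<Rightarrow> ennreal" where
  "ess_profile v c x = esssup (lebesgue_on {c<..<x}) (\<lambda>t. 1 / v t)"

definition profile :: "real \<Rightarrow> (real \<Rightarrow> ennreal) \<Rightarrow> real \<Rightarrow> real \<Rightarrow> real \<Rightarrow> ennreal" where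
  "profile p v c d x =
     (if p = 1
      then if x < d then Lim (at_right x) (ess_profile v c) else ess_profile v c d
      else epowr (\<integral>\<^sup>+t\<in>{c..x}. epowr (v t) (1 - conj_exp p) \<partial>lebesgue) (1 / conj_exp p))"

text \<open>
  \<open>G\<close> is extended by zero to the left of \<open>c\<close> (which produces the atom of mass \<open>G c\<close> at \<open>c\<close>) and
  by the constant \<open>G d\<close> to the right of \<open>d\<close>.
\<close>
definition stieltjes :: "(real \<Rightarrow> real) \<Rightarrow> real \<Rightarrow> real \<Rightarrow> real measure" where
  "stieltjes G c d =
     restrict_space (interval_measure (\<lambda>x. if x < c then 0 else G (min x d))) {c..d}"

lemma emeasure_stieltjes_Icc:
  assumes cd: "c < d" and mono: "mono_on {c..d} G" and nonneg: "0 \<le> G c"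
    and rc: "\<And>x. c \<le> x \<Longrightarrow> x < d \<Longrightarrow> continuous (at_right x) G"
    and x: "x \<in> {c..d}"
  shows "emeasure (stieltjes G c d) {c..x} = ennreal (G x)"
proof -
  define F where "F = (\<lambda>x. if x < c then 0 else G (min x d))"
  have ge0: "0 \<le> G y" if "c \<le> y" "y \<le> d" for y
    using mono_onD[OF mono, of c y] that cd nonneg by auto
  have monoF: "F a \<le> F b" if "a \<le> b" for a b
    using that cd ge0[of "min b d"] mono_onD[OF mono, of "min a d" "min b d"]
    by (auto simp: F_def)
  have rcF: "continuous (at_right a) F" for a
  proof -
    consider "a < c" | "c \<le> a" "a < d" | "d \<le> a" by linarith
    then show ?thesis
    proof cases
      case 1
      have "eventually (\<lambda>y. F y = 0) (at_right a)"
        using eventually_at_right_less[of a] eventually_at_right_field[of _ a] 1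
        by (auto simp: F_def eventually_at_right_field intro: exI[of _ c])
      moreover have "F a = 0" using 1 by (simp add: F_def)
      ultimately show ?thesis
        unfolding continuous_within by (simp add: tendsto_eventually)
    next
      case 2
      have "eventually (\<lambda>y. G y = F y) (at_right a)"
        using 2 by (auto simp: F_def eventually_at_right_field intro!: exI[of _ d])
      moreover have "F a = G a" using 2 by (simp add: F_def)
      ultimately show ?thesis
        using rc[OF 2] unfolding continuous_within by (metis Lim_transform_eventually)
    next
      case 3
      have "eventually (\<lambda>y. F y = F a) (at_right a)"
        using 3 cd by (auto simp: F_def eventually_at_right_field intro!: exI[of _ "a + 1"])
      then show ?thesis
        unfolding continuous_within by (simp add: tendsto_eventually)
    qed
  qed
  have Ioc: "emeasure (interval_measure F) {a<..b} = ennreal (F b - F a)" if "a \<le> b" for a b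
    by (rule emeasure_interval_measure_Ioc[OF that monoF rcF])
  have "emeasure (interval_measure F) (\<Inter>n. {c - 1 / Suc n<..x}) =
        (INF n. emeasure (interval_measure F) {c - 1 / Suc n<..x})"
  proof (rule INF_emeasure_decseq[symmetric])
    show "range (\<lambda>n. {c - 1 / Suc n<..x}) \<subseteq> sets (interval_measure F)" by auto
    have "1 / real (Suc n) \<le> 1 / real (Suc m)" if "m \<le> n" for m n
      using that by (intro divide_left_mono) auto
    then show "decseq (\<lambda>n. {c - 1 / Suc n<..x})"
      by (fastforce simp: decseq_def intro: order.strict_trans1)
    show "emeasure (interval_measure F) {c - 1 / Suc n<..x} \<noteq> \<infinity>" for n
    proof -
      have "c - 1 / Suc n \<le> c" by simp
      then have "c - 1 / Suc n \<le> x" using x by (simp only: atLeastAtMost_iff) linarith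
      then show ?thesis by (simp only: Ioc) simp
    qed
  qed
  also have "(INF n. emeasure (interval_measure F) {c - 1 / Suc n<..x}) = ennreal (G x)"
  proof -
    have "emeasure (interval_measure F) {c - 1 / Suc n<..x} = ennreal (G x)" for n
    proof -
      have lt: "c - 1 / Suc n < c" by simp
      moreover have cx: "c \<le> x" "x \<le> d" using x by auto
      ultimately have le: "c - 1 / Suc n \<le> x" by linarith
      have "F (c - 1 / Suc n) = 0" "F x = G x" using lt cx by (simp_all add: F_def)
      then show ?thesis using Ioc[OF le] by simp
    qed
    then show ?thesis by simp
  qed
  also have "(\<Inter>n. {c - 1 / Suc n<..x}) = {c..x}"
  proof (intro equalityI subsetI)
    fix y assume y: "y \<in> (\<Inter>n. {c - 1 / Suc n<..x})"
    have "c \<le> y"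
    proof (rule ccontr)
      assume "\<not> c \<le> y"
      then obtain n where "1 / real (Suc n) < c - y"
        using nat_approx_posE[of "c - y"] by auto
      moreover have "c - 1 / Suc n < y" using y by auto
      ultimately show False by linarith
    qed
    then show "y \<in> {c..x}" using y by auto
  next
    fix y assume y: "y \<in> {c..x}"
    have "c - 1 / Suc n < y" for n
    proof -
      have "c - 1 / Suc n < c" by simp
      also have "c \<le> y" using y by simp
      finally show ?thesis .
    qed
    then show "y \<in> (\<Inter>n. {c - 1 / Suc n<..x})"
      using y by (simp only: INT_iff greaterThanAtMost_iff atLeastAtMost_iff) simp
  qed
  finally show ?thesis
    using x unfolding stieltjes_def F_def
    by (subst emeasure_restrict_space) auto
qed

definition hardy_A_le ::
  "real \<Rightarrow> real \<Rightarrow> (real \<Rightarrow> ennreal) \<Rightarrow> (real \<Rightarrow> ennreal) \<Rightarrow> real \<Rightarrow> real \<Rightarrow> ennreal" where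
  "hardy_A_le p q v w c d = (SUP x\<in>{c..d}. profile p v c d x * epowr (tail_int d w x) (1 / q))"

text \<open>
  The measure $d(\Phi^r)$. For a regular weight \<open>v\<close> the profile is finite on \<open>[c,d]\<close>, so
  \<^const>\<open>enn2real\<close> loses nothing here.
\<close>
definition profile_measure ::
  "real \<Rightarrow> real \<Rightarrow> (real \<Rightarrow> ennreal) \<Rightarrow> real \<Rightarrow> real \<Rightarrow> real measure" where
  "profile_measure p r v c d = stieltjes (\<lambda>x. enn2real (epowr (profile p v c d x) r)) c d"

definition hardy_A_lt ::
  "real \<Rightarrow> real \<Rightarrow> real \<Rightarrow> (real \<Rightarrow> ennreal) \<Rightarrow> (real \<Rightarrow> ennreal) \<Rightarrow> real \<Rightarrow> real \<Rightarrow> ennreal" where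
  "hardy_A_lt p q r v w c d =
     epowr (\<integral>\<^sup>+x\<in>{c..d}. epowr (tail_int d w x) (r / q) \<partial>profile_measure p r v c d) (1 / r)"

end

theory Submission
  imports Defs
begin

text \<open>
  A weight \<open>v\<close> enters the Hardy inequality only through the best constant in
  \<open>\<integral>\<^sub>c\<^sup>x h \<le> C \<parallel>h\<parallel>\<close> for each single \<open>x\<close>, and this constant is the profile
  (for \<open>p = 1\<close>, its left limit). One half of this is Hoelder's inequality (a factor 2 is given away,
  since the equivalence is only up to constants); the other half says that for every \<open>s\<close> below the profile at \<open>x\<close> there is an \<open>h\<close> with norm
  at most \<open>1 / s\<close> and mass at least 1 on \<open>[c,x]\<close>. The locale \<open>hardy_profile\<close> records these two
  facts, together with the order and continuity properties of the profile. Beyond measurability, no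
  other property of \<open>v\<close> enters the estimates, so that \<open>p = 1\<close> and \<open>p > 1\<close>, and all
  \<open>q > 0\<close>, are treated by the same argument.

  The upper bound is obtained by cutting \<open>[c,d]\<close> at points \<open>z n\<close> where the profile passes the level
  \<open>lam n = F d / 4 ^ n\<close>. If \<open>x\<^sub>n\<close> is \<open>\<integral>\<^sub>c\<^sup>z h\<close> at \<open>z = z n\<close>, divided by \<open>lam n\<close>, and \<open>E\<^sub>n\<close> is the integral
  of \<open>h\<^sup>p v\<close> over \<open>(z (n + 1), z n]\<close>, then Hoelder's inequality on this piece gives
  \<open>x\<^sub>n \<le> x\<^sub>n\<^sub>+\<^sub>1 / 4 + 2 E\<^sub>n\<^sup>1\<^sup>/\<^sup>p\<close>. The factor \<open>1 / 4\<close> makes this a contraction, and \<open>geometric_hardy\<close>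
  bounds \<open>\<Sum> x\<^sub>n\<^sup>p\<close> by the integral of \<open>h\<^sup>p v\<close>. With \<open>W\<close> the tail integral of \<open>w\<close>, what remains is
  the sum of the terms \<open>(lam n * x\<^sub>n)\<^sup>q W (z (n + 1))\<close>. For \<open>p \<le> q\<close> one inserts \<open>lam n * W\<^sup>1\<^sup>/\<^sup>q \<le> 4 A\<close>
  and uses that the \<open>\<ell>\<^sup>q\<close> norm is at most the \<open>\<ell>\<^sup>p\<close> norm; for \<open>q < p\<close> one uses Hoelder's inequality
  for sums, which produces the sum of the terms \<open>lam n\<^sup>r W (z n)\<^sup>r\<^sup>/\<^sup>q\<close>.

  The lower bound for \<open>p \<le> q\<close> tests with one extremal function. For \<open>q < p\<close> the test function is
  a maximum of multiples \<open>b\<^sub>n h\<^sub>n\<close> of functions \<open>h\<^sub>n\<close> extremal at points just to the right of the \<open>z n\<close>.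
  The coefficients at least double from each point to the next one on the right. Hence
  \<open>(H h)\<^sup>q\<close> dominates a multiple of the sum, and not only the maximum, of the \<open>b\<^sub>n\<^sup>q\<close> that are
  switched on (\<open>geometric_tail_sum\<close>), while the levels grow by the factor 4, so that
  \<open>geometric_hardy\<close> also controls the norm. Taking a maximum makes disjoint supports
  unnecessary; for \<open>p = 1\<close> the extremal functions may concentrate anywhere to the left of their
  points.

  Finally \<open>\<integral> W\<^sup>r\<^sup>/\<^sup>q d\<Phi>\<^sup>r\<close> is comparable with the sum of the \<open>lam n\<^sup>r W (z n)\<^sup>r\<^sup>/\<^sup>q\<close>: one direction by
  summation by parts (\<open>sum_le_profile_integral\<close>), the other by decomposing \<open>[c,d]\<close> into the sets
  on which \<open>\<Phi>\<close> lies between two consecutive levels (\<open>profile_integral_le_sum\<close>). The atom of the measure at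
  \<open>c\<close> for \<open>p = 1\<close> corresponds to the levels below \<open>\<Phi> c\<close>, for which \<open>z n = c\<close>.
\<close>

section \<open>Extended powers and elementary inequalities\<close>

lemma epowr_ennreal_pos: "0 \<le> x \<Longrightarrow> 0 < a \<Longrightarrow> epowr (ennreal x) a = ennreal (x powr a)"
  by (cases "x = 0") (auto simp: epowr_def epowr_ennreal)

lemma epowr_top [simp]: "0 < a \<Longrightarrow> epowr top a = top"
  by (simp add: epowr_def)

lemma epowr_zero [simp]: "0 < a \<Longrightarrow> epowr 0 a = 0"
  by (simp add: epowr_def)

lemma epowr_mono:
  assumes "0 < a" "x \<le> y" shows "epowr x a \<le> epowr y a"
proof (cases y)
  case (real s)
  then obtain r where "x = ennreal r" "0 \<le> r" using assms(2) by (cases x) (auto simp: top_unique)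
  then show ?thesis using real assms by (auto simp: epowr_ennreal_pos intro!: ennreal_leI powr_mono2)
qed (use assms in simp)

lemma epowr_one [simp]: "epowr x 1 = x"
  by (cases x) (auto simp: epowr_ennreal_pos)

lemma measurable_epowr [measurable]:
  assumes [measurable]: "f \<in> borel_measurable M"
  shows "(\<lambda>x. epowr (f x) a) \<in> borel_measurable M"
  unfolding epowr_def by measurable

lemma epowr_indicator: "0 < a \<Longrightarrow> epowr (x * indicator S t) a = epowr x a * indicator S t"
  by (auto simp: indicator_def)

lemma epowr_root_le_iff:
  assumes "0 < a" shows "epowr x (1 / a) \<le> y \<longleftrightarrow> x \<le> epowr y a"
proof -
  have "x \<le> epowr y a" if "epowr x (1 / a) \<le> y"
  proof -
    have "epowr (epowr x (1 / a)) a = x"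
      using assms by (cases x) (auto simp: epowr_ennreal_pos powr_powr)
    then show ?thesis using epowr_mono[OF assms that] by simp
  qed
  moreover have "epowr x (1 / a) \<le> y" if "x \<le> epowr y a"
  proof -
    have "epowr (epowr y a) (1 / a) = y"
      using assms by (cases y) (auto simp: epowr_ennreal_pos powr_powr)
    then show ?thesis using epowr_mono[OF _ that, of "1 / a"] assms by simp
  qed
  ultimately show ?thesis by blast
qed

text \<open>
  Convexity on the open half-line leaves the boundary point 0, where the claim reduces to
  \<open>2 \<le> 2 powr p\<close>.
\<close>
lemma convex_powr_midpoint:
  fixes a b p :: real
  assumes "1 \<le> p" "0 \<le> a" "0 \<le> b"
  shows "((a + b) / 2) powr p \<le> (a powr p + b powr p) / 2"
proof (cases "a = 0 \<or> b = 0")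
  case True
  have half: "(s / 2) powr p \<le> s powr p / 2" if "0 \<le> s" for s :: real
  proof -
    have "(2::real) powr 1 \<le> 2 powr p" using assms by (intro powr_mono) auto
    then have "s powr p / 2 powr p \<le> s powr p / 2" by (intro divide_left_mono) auto
    then show ?thesis using that by (simp add: powr_divide)
  qed
  then show ?thesis using True assms half[of a] half[of b] by auto
next
  case False
  then have "0 < a" "0 < b" using assms by auto
  then show ?thesis
    using convex_onD[OF powr_convex[OF assms(1)], of "1/2" a b] by (simp add: field_simps)
qed

text \<open>
  By convexity \<open>x\<^sub>n\<^sup>p\<close> is at most half of \<open>x\<^sub>n\<^sub>+\<^sub>1\<^sup>p + (2 e\<^sub>n)\<^sup>p\<close>; summing, half of the left-hand side is
  absorbed. This discrete Hardy inequality with geometric weights is used for both the upper and the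
  lower bound.
\<close>
lemma geometric_hardy:
  fixes x e :: "nat \<Rightarrow> real"
  assumes p: "1 \<le> p" and x: "\<And>n. 0 \<le> x n" and e: "\<And>n. 0 \<le> e n"
    and rec: "\<And>n. n < N \<Longrightarrow> x n \<le> x (Suc n) / 2 + e n"
  shows "(\<Sum>n<N. x n powr p) \<le> x N powr p + 2 powr p * (\<Sum>n<N. e n powr p)"
proof -
  have step: "x n powr p \<le> (x (Suc n) powr p + 2 powr p * e n powr p) / 2" if "n < N" for n
  proof -
    have "x n powr p \<le> ((x (Suc n) + 2 * e n) / 2) powr p"
      using rec[OF that] x p by (intro powr_mono2) auto
    also have "\<dots> \<le> (x (Suc n) powr p + (2 * e n) powr p) / 2"
      using x e p by (intro convex_powr_midpoint) auto
    finally show ?thesis by (simp add: powr_mult e)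
  qed
  have "(\<Sum>n<N. x n powr p) \<le> (\<Sum>n<N. (x (Suc n) powr p + 2 powr p * e n powr p) / 2)"
    using step by (intro sum_mono) auto
  also have "\<dots> = ((\<Sum>n<N. x (Suc n) powr p) + 2 powr p * (\<Sum>n<N. e n powr p)) / 2"
    by (simp add: sum.distrib sum_divide_distrib[symmetric] sum_distrib_left[symmetric])
  finally have 1: "2 * (\<Sum>n<N. x n powr p) \<le> (\<Sum>n<N. x (Suc n) powr p) + 2 powr p * (\<Sum>n<N. e n powr p)"
    by simp
  have "(\<Sum>n<N. x (Suc n) powr p) + x 0 powr p = (\<Sum>n<N. x n powr p) + x N powr p"
    using sum.lessThan_Suc_shift[of "\<lambda>n. x n powr p" N] by simp
  moreover have "0 \<le> x 0 powr p" by simp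
  ultimately show ?thesis using 1 by linarith
qed

text \<open>
  Coefficients that decrease by a factor of at least 2 have \<open>q\<close>-th powers dominated by a geometric
  series, for every \<open>q > 0\<close>; so their sum is comparable with its first term.
\<close>
lemma geometric_tail_sum:
  fixes b :: "nat \<Rightarrow> real"
  assumes q: "0 < q" and b: "\<And>n. 0 \<le> b n" and half: "\<And>n. n < N \<Longrightarrow> 2 * b (Suc n) \<le> b n" and mN: "m \<le> N" and bN: "b N = 0"
  shows "(\<Sum>n\<in>{m..<N}. b n powr q) \<le> b m powr q / (1 - 2 powr - q)"
  using mN
proof (induction rule: inc_induct)
  case base
  then show ?case using bN by simp
next
  case (step n)
  have lt: "2 powr - q < (1 :: real)" using q powr_less_mono[of "- q" 0 2] by simp
  have "(2 * b (Suc n)) powr q \<le> b n powr q"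
    using half[of n] b[of "Suc n"] step q by (intro powr_mono2) auto
  then have "b (Suc n) powr q \<le> 2 powr - q * b n powr q"
    using b[of "Suc n"] by (simp add: powr_mult powr_minus field_simps)
  then have "b (Suc n) powr q / (1 - 2 powr - q) \<le> 2 powr - q * b n powr q / (1 - 2 powr - q)"
    using lt by (intro divide_right_mono) auto
  with step.IH have "(\<Sum>n\<in>{Suc n..<N}. b n powr q) \<le> 2 powr - q * b n powr q / (1 - 2 powr - q)"
    by linarith
  moreover have "(\<Sum>n\<in>{n..<N}. b n powr q) = b n powr q + (\<Sum>n\<in>{Suc n..<N}. b n powr q)"
    using step by (simp add: sum.atLeast_Suc_lessThan)
  moreover have "s + u * s / (1 - u) = s / (1 - u)" if "u < 1" for s u :: real
    using that by (simp add: field_simps)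
  from this[OF lt] have "b n powr q + 2 powr - q * b n powr q / (1 - 2 powr - q) = b n powr q / (1 - 2 powr - q)" .
  ultimately show ?case by linarith
qed

text \<open>
  Young's inequality without the sharp constants: either \<open>y\<close> is at most \<open>\<alpha> g\<^sup>1\<^sup>/\<^sup>(\<^sup>P\<^sup>-\<^sup>1\<^sup>)\<close>, and the first term
  suffices, or it is larger, and then \<open>g\<close> is bounded by a power of \<open>y\<close> and the second term suffices.
\<close>
lemma young_splitting:
  fixes y g \<alpha> P :: real
  assumes P: "1 < P" and "0 \<le> y" "0 \<le> g" "0 < \<alpha>"
  shows "y * g \<le> \<alpha> * g powr (P / (P - 1)) + \<alpha> powr (1 - P) * y powr P"
proof (cases "g = 0 \<or> y = 0")
  case False
  then have pos: "0 < y" "0 < g" using assms by auto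
  let ?s = "\<alpha> * g powr (1 / (P - 1))"
  have e: "g powr (1 / (P - 1)) * g = g powr (P / (P - 1))"
  proof -
    have "g powr (1 / (P - 1)) * g powr 1 = g powr (1 / (P - 1) + 1)" by (simp add: powr_add)
    moreover have "1 / (P - 1) + 1 = P / (P - 1)" using P by (simp add: field_simps)
    ultimately show ?thesis using pos by simp
  qed
  show ?thesis
  proof (cases "y \<le> ?s")
    case True
    then have "y * g \<le> ?s * g" using pos by (intro mult_right_mono) auto
    also have "\<dots> = \<alpha> * g powr (P / (P - 1))" using e by (simp add: mult.assoc)
    finally show ?thesis by (simp add: add_increasing2)
  next
    case False
    have "?s powr (P - 1) \<le> y powr (P - 1)" using False pos assms by (intro powr_mono2) auto
    moreover have "?s powr (P - 1) = \<alpha> powr (P - 1) * g"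
      using pos assms by (simp add: powr_mult powr_powr)
    ultimately have "\<alpha> powr (1 - P) * (\<alpha> powr (P - 1) * g) \<le> \<alpha> powr (1 - P) * y powr (P - 1)"
      by (intro mult_left_mono) auto
    moreover have "\<alpha> powr (1 - P) * \<alpha> powr (P - 1) = 1"
      using assms(4) by (simp add: powr_add[symmetric])
    ultimately have "g \<le> \<alpha> powr (1 - P) * y powr (P - 1)"
      by (simp only: mult.assoc[symmetric] mult_1_left)
    then have "y * g \<le> y * (\<alpha> powr (1 - P) * y powr (P - 1))" using pos by (intro mult_left_mono) auto
    also have "\<dots> = \<alpha> powr (1 - P) * y powr P"
      using pos by (simp add: powr_diff field_simps)
    finally show ?thesis using assms(4) by (simp add: add_increasing)
  qed
qed (use assms in auto)

text \<open>
  This \<open>\<alpha>\<close> makes the two terms of the splitting equal, so the sum is twice a weighted geometric mean.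
\<close>
lemma balanced_splitting:
  fixes S G P :: real
  assumes P: "1 < P" and pos: "0 < S" "0 < G"
  defines "\<alpha> \<equiv> (S / G) powr (1 / P)"
  shows "\<alpha> * G + \<alpha> powr (1 - P) * S = 2 * S powr (1 / P) * G powr (1 - 1 / P)"
proof -
  have "\<alpha> * G = S powr (1 / P) * G powr (1 - 1 / P)"
    using pos by (simp only: \<alpha>_def powr_divide powr_diff powr_one) simp
  moreover have "\<alpha> powr (1 - P) * S = S powr (1 / P) * G powr (1 - 1 / P)"
  proof -
    have "1 / P * (1 - P) = 1 / P - 1" using P by (simp add: field_simps)
    then have "\<alpha> powr (1 - P) = (S / G) powr (1 / P - 1)" by (simp only: \<alpha>_def powr_powr)
    then show ?thesis
      using pos by (simp only: powr_divide powr_diff powr_one) (simp add: field_simps)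
  qed
  ultimately show ?thesis by simp
qed

lemma sum_hoelder:
  fixes y g :: "'a \<Rightarrow> real"
  assumes P: "1 < P" and fin: "finite I" and y: "\<And>i. i \<in> I \<Longrightarrow> 0 \<le> y i" and g: "\<And>i. i \<in> I \<Longrightarrow> 0 \<le> g i"
    and S: "(\<Sum>i\<in>I. y i powr P) \<le> S" and G: "(\<Sum>i\<in>I. g i powr (P / (P - 1))) \<le> G"
  shows "(\<Sum>i\<in>I. y i * g i) \<le> 2 * S powr (1 / P) * G powr (1 - 1 / P)"
proof (cases "0 < S \<and> 0 < G")
  case False
  have "S \<ge> 0" "G \<ge> 0" using order_trans[OF sum_nonneg S] order_trans[OF sum_nonneg G] by auto
  with False S G consider "(\<Sum>i\<in>I. y i powr P) \<le> 0" | "(\<Sum>i\<in>I. g i powr (P / (P - 1))) \<le> 0"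
    by fastforce
  then have "\<forall>i\<in>I. y i * g i = 0"
  proof cases
    case 1
    then have "(\<Sum>i\<in>I. y i powr P) = 0" by (intro antisym sum_nonneg) auto
    then show ?thesis using fin by (simp add: sum_nonneg_eq_0_iff)
  next
    case 2
    then have "(\<Sum>i\<in>I. g i powr (P / (P - 1))) = 0" by (intro antisym sum_nonneg) auto
    then show ?thesis using fin by (simp add: sum_nonneg_eq_0_iff)
  qed
  then have "(\<Sum>i\<in>I. y i * g i) = 0" by (intro sum.neutral)
  then show ?thesis by simp
next
  case True
  then have pos: "0 < S" "0 < G" by auto
  define \<alpha> where "\<alpha> = (S / G) powr (1 / P)"
  have a: "0 < \<alpha>" using pos by (simp add: \<alpha>_def)
  have "(\<Sum>i\<in>I. y i * g i) \<le> (\<Sum>i\<in>I. \<alpha> * g i powr (P / (P - 1)) + \<alpha> powr (1 - P) * y i powr P)"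
    using young_splitting[OF P y g a] by (intro sum_mono) auto
  also have "\<dots> = \<alpha> * (\<Sum>i\<in>I. g i powr (P / (P - 1))) + \<alpha> powr (1 - P) * (\<Sum>i\<in>I. y i powr P)"
    by (simp add: sum.distrib sum_distrib_left)
  also have "\<dots> \<le> \<alpha> * G + \<alpha> powr (1 - P) * S"
    using a S G by (intro add_mono mult_left_mono) auto
  also have "\<dots> = 2 * S powr (1 / P) * G powr (1 - 1 / P)"
    unfolding \<alpha>_def using P pos by (intro balanced_splitting)
  finally show ?thesis .
qed

text \<open>
  The inclusion of \<open>\<ell>\<^sup>p\<close> in \<open>\<ell>\<^sup>q\<close>: each \<open>x\<^sub>i\<close> is at most \<open>S\<^sup>1\<^sup>/\<^sup>p\<close>, so \<open>x\<^sub>i\<^sup>q\<close> is at most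
  \<open>S\<^sup>(\<^sup>q\<^sup>-\<^sup>p\<^sup>)\<^sup>/\<^sup>p x\<^sub>i\<^sup>p\<close>.
\<close>
lemma sum_powr_le_powr_sum:
  fixes x :: "'a \<Rightarrow> real"
  assumes p: "0 < p" "p \<le> q" and x: "\<And>i. i \<in> I \<Longrightarrow> 0 \<le> x i" and fin: "finite I"
    and S: "(\<Sum>i\<in>I. x i powr p) \<le> S"
  shows "(\<Sum>i\<in>I. x i powr q) \<le> S powr (q / p)"
proof -
  have S0: "0 \<le> S" using S sum_nonneg[of I "\<lambda>i. x i powr p"] by simp
  have "x i powr q \<le> S powr ((q - p) / p) * x i powr p" if "i \<in> I" for i
  proof -
    have "x i powr p \<le> (\<Sum>i\<in>I. x i powr p)" using that fin by (intro member_le_sum) auto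
    then have "(x i powr p) powr ((q - p) / p) \<le> S powr ((q - p) / p)"
      using S p by (intro powr_mono2) auto
    then have "x i powr (q - p) \<le> S powr ((q - p) / p)" using p by (simp add: powr_powr)
    then have "x i powr (q - p) * x i powr p \<le> S powr ((q - p) / p) * x i powr p"
      by (intro mult_right_mono) auto
    then show ?thesis by (simp add: powr_add[symmetric])
  qed
  then have "(\<Sum>i\<in>I. x i powr q) \<le> S powr ((q - p) / p) * (\<Sum>i\<in>I. x i powr p)"
    by (simp add: sum_distrib_left sum_mono)
  also have "\<dots> \<le> S powr ((q - p) / p) * S" using S by (intro mult_left_mono) auto
  also have "\<dots> = S powr (q / p)"
    using S0 p by (cases "S = 0") (simp_all add: diff_divide_distrib powr_diff)
  finally show ?thesis .
qed

lemma exponent_gap_pos: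
  fixes p q r :: real
  assumes "0 < q" "q < p" "1 / r = 1 / q - 1 / p"
  shows "0 < r"
proof -
  have "1 / p < 1 / q" using assms by (intro divide_strict_left_mono) auto
  then have "0 < 1 / r" using assms(3) by simp
  then show ?thesis by simp
qed

lemma set_nn_integral_lebesgue_on:
  fixes c d :: real
  assumes "A \<subseteq> {c..d}"
  shows "(\<integral>\<^sup>+t\<in>A. f t \<partial>lebesgue) = (\<integral>\<^sup>+t. f t * indicator A t \<partial>lebesgue_on {c..d})"
  using assms by (subst nn_integral_restrict_space) (auto simp: indicator_def intro!: nn_integral_cong)

section \<open>Abstract profiles\<close>

text \<open>
  Two versions of the profile are carried along. The left-continuous \<open>F\<close> depends only on \<open>v\<close>
  to the left of \<open>x\<close> and satisfies \<open>hoelder\<close> and \<open>extremal\<close>; the right-continuous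
  \<open>\<Phi>\<close> has a Stieltjes measure. They agree for \<open>p > 1\<close>, and for \<open>p = 1\<close> they differ at the jumps of the
  essential supremum. Left continuity is stated as preservation of upper bounds. The finiteness
  hypothesis in \<open>hoelder\<close> excludes the indefinite case \<open>0 * \<infinity>\<close>, which occurs when \<open>v = \<infinity>\<close> on
  \<open>[c,x]\<close>.
\<close>
locale hardy_profile =
  fixes p q c d :: real and v w :: "real \<Rightarrow> ennreal" and F \<Phi> :: "real \<Rightarrow> real"
  assumes p: "1 \<le> p" and q: "0 < q" and cd: "c < d"
    and v_meas [measurable]: "v \<in> borel_measurable (lebesgue_on {c..d})"
    and w_meas [measurable]: "w \<in> borel_measurable (lebesgue_on {c..d})"
    and w_fin: "(\<integral>\<^sup>+t. w t \<partial>lebesgue_on {c..d}) < \<infinity>"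
    and F_mono: "mono_on {c..d} F" and F_c: "F c = 0"
    and F_left: "\<And>x s. c < x \<Longrightarrow> x \<le> d \<Longrightarrow> (\<And>y. c \<le> y \<Longrightarrow> y < x \<Longrightarrow> F y \<le> s) \<Longrightarrow> F x \<le> s"
    and F_le_\<Phi>: "\<And>x. x \<in> {c..d} \<Longrightarrow> F x \<le> \<Phi> x"
    and \<Phi>_le_F: "\<And>x y. c \<le> x \<Longrightarrow> x < y \<Longrightarrow> y \<le> d \<Longrightarrow> \<Phi> x \<le> F y"
    and \<Phi>_d: "\<Phi> d = F d"
    and \<Phi>_right: "\<And>x. c \<le> x \<Longrightarrow> x < d \<Longrightarrow> continuous (at_right x) \<Phi>"
    and hoelder: "\<And>h x. h \<in> borel_measurable (lebesgue_on {c..d}) \<Longrightarrow>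
        (\<integral>\<^sup>+t. epowr (h t) p * v t \<partial>lebesgue_on {c..d}) < \<infinity> \<Longrightarrow> x \<in> {c..d} \<Longrightarrow>
        (\<integral>\<^sup>+t. h t * indicator {c..x} t \<partial>lebesgue_on {c..d})
          \<le> ennreal (2 * F x * enn2real (\<integral>\<^sup>+t. epowr (h t) p * v t \<partial>lebesgue_on {c..d}) powr (1 / p))"
    and extremal: "\<And>x s. x \<in> {c..d} \<Longrightarrow> 0 < s \<Longrightarrow> s < F x \<Longrightarrow>
        \<exists>h\<in>borel_measurable (lebesgue_on {c..d}).
          1 \<le> (\<integral>\<^sup>+t. h t * indicator {c..x} t \<partial>lebesgue_on {c..d}) \<and>
          (\<integral>\<^sup>+t. epowr (h t) p * v t \<partial>lebesgue_on {c..d}) \<le> ennreal (s powr - p)"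
begin

abbreviation "M \<equiv> lebesgue_on {c..d}"

definition W :: "real \<Rightarrow> real" where
  "W x = enn2real (\<integral>\<^sup>+t. w t * indicator {x..d} t \<partial>M)"

definition H :: "(real \<Rightarrow> ennreal) \<Rightarrow> real \<Rightarrow> ennreal" where
  "H h x = (\<integral>\<^sup>+t. h t * indicator {c..x} t \<partial>M)"

definition energy :: "(real \<Rightarrow> ennreal) \<Rightarrow> ennreal" where
  "energy h = (\<integral>\<^sup>+t. epowr (h t) p * v t \<partial>M)"

text \<open>
  The Hardy inequality in terms of \<open>q\<close>-th powers and for \<open>h\<close> of finite energy only; this keeps all
  quantities on the right-hand side real.
\<close>
definition admissible :: "real \<Rightarrow> bool" where
  "admissible L \<longleftrightarrow> 0 \<le> L \<and> (\<forall>h\<in>borel_measurable M. energy h < \<infinity> \<longrightarrow>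
     (\<integral>\<^sup>+x. epowr (H h x) q * w x \<partial>M) \<le> ennreal ((L * enn2real (energy h) powr (1 / p)) powr q))"

definition lam :: "nat \<Rightarrow> real" where
  "lam n = F d / 4 ^ n"

text \<open>
  The last point at which the profile does not exceed \<open>lam n\<close>. The levels are indexed downwards, so
  \<open>z\<close> is decreasing and starts at \<open>d\<close>. For \<open>p = 1\<close> several consecutive points may coincide at a jump.
\<close>
definition z :: "nat \<Rightarrow> real" where
  "z n = Sup {x\<in>{c..d}. F x \<le> lam n}"

lemma endpoints_mem: "c \<in> {c..d}" "d \<in> {c..d}"
  using cd by auto

lemma indicator_meas [measurable]: "A \<in> sets borel \<Longrightarrow> indicator A \<in> borel_measurable M"
  by (intro measurable_restrict_space1 borel_measurable_indicator) auto

lemma F_nonneg: "x \<in> {c..d} \<Longrightarrow> 0 \<le> F x"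
  using mono_onD[OF F_mono, of c x] cd F_c by auto

lemma F_le: "c \<le> x \<Longrightarrow> x \<le> y \<Longrightarrow> y \<le> d \<Longrightarrow> F x \<le> F y"
  using mono_onD[OF F_mono, of x y] by auto

lemma \<Phi>_nonneg: "x \<in> {c..d} \<Longrightarrow> 0 \<le> \<Phi> x"
  using F_nonneg[of x] F_le_\<Phi>[of x] by linarith

lemma \<Phi>_le: "c \<le> x \<Longrightarrow> x \<le> y \<Longrightarrow> y \<le> d \<Longrightarrow> \<Phi> x \<le> \<Phi> y"
  using \<Phi>_le_F[of x y] F_le_\<Phi>[of y] by (cases "x = y") auto

lemma W_ennreal: "(\<integral>\<^sup>+t. w t * indicator {x..d} t \<partial>M) = ennreal (W x)"
proof -
  have "(\<integral>\<^sup>+t. w t * indicator {x..d} t \<partial>M) \<le> (\<integral>\<^sup>+t. w t \<partial>M)"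
    by (intro nn_integral_mono) (simp add: indicator_def)
  then show ?thesis using w_fin unfolding W_def by (simp add: ennreal_enn2real_if top.not_eq_extremum)
qed

lemma W_nonneg: "0 \<le> W x"
  by (simp add: W_def)

lemma W_antimono: "x \<le> y \<Longrightarrow> W y \<le> W x"
proof -
  assume "x \<le> y"
  then have "ennreal (W y) \<le> ennreal (W x)"
    unfolding W_ennreal[symmetric] by (intro nn_integral_mono) (auto simp: indicator_def)
  then show ?thesis using W_nonneg by simp
qed

text \<open>
  Extremal functions exist at points strictly to the right of \<open>z n\<close>; this lemma allows moving there
  at an arbitrarily small loss in \<open>W\<close>.
\<close>
lemma W_right_continuous:
  assumes x: "c \<le> x" "x < d" and \<eta>: "\<eta> < W x"
  shows "\<exists>y. x < y \<and> y < d \<and> \<eta> < W y"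
proof (cases "\<eta> < 0")
  case True
  then show ?thesis using dense[OF x(2)] W_nonneg by (meson order_less_le_trans)
next
  case False
  define N where "N = density M w"
  define A where "A = (\<lambda>n. {x + (d - x) / real (n + 2)..d})"
  have A_meas: "A n \<in> sets M" for n
    unfolding A_def using x by (auto simp: sets_restrict_space_iff add_increasing2)
  have em: "emeasure N (A n) = ennreal (W (x + (d - x) / real (n + 2)))" for n
    unfolding N_def using A_meas by (simp add: emeasure_density A_def W_ennreal)
  have inc: "incseq A"
  proof (rule incseq_SucI)
    fix n
    have "(d - x) / real (Suc n + 2) \<le> (d - x) / real (n + 2)"
      using x by (intro divide_left_mono) auto
    then show "A n \<subseteq> A (Suc n)" unfolding A_def by auto
  qed
  have un: "(\<Union>n. A n) = {x<..d}"
  proof (intro equalityI subsetI)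
    fix y assume "y \<in> (\<Union>n. A n)"
    then obtain n where n: "x + (d - x) / real (n + 2) \<le> y" "y \<le> d" by (auto simp: A_def)
    have "0 < (d - x) / real (n + 2)" using x by simp
    then have "x < y" using n by linarith
    then show "y \<in> {x<..d}" using n by simp
  next
    fix y assume y: "y \<in> {x<..d}"
    then obtain n where n: "(d - x) / (y - x) < real n" using reals_Archimedean2 by blast
    have "(d - x) / real (n + 2) \<le> y - x"
      using n y by (auto simp: field_simps)
    then have "y \<in> A n" using y by (auto simp: A_def)
    then show "y \<in> (\<Union>n. A n)" by blast
  qed
  have "emeasure N {x<..d} = ennreal (W x)"
  proof -
    have "AE t in M. t \<noteq> x"
    proof (rule AE_I')
      show "{x} \<in> null_sets M" using x by (subst null_sets_restrict_space) auto
    qed auto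
    then have "(\<integral>\<^sup>+t. w t * indicator {x<..d} t \<partial>M) = (\<integral>\<^sup>+t. w t * indicator {x..d} t \<partial>M)"
      by (intro nn_integral_cong_AE) (auto simp: indicator_def elim!: eventually_mono)
    moreover have "{x<..d} \<in> sets M" using x by (auto simp: sets_restrict_space_iff)
    ultimately show ?thesis by (simp add: N_def emeasure_density W_ennreal)
  qed
  moreover have "(SUP n. emeasure N (A n)) = emeasure N (\<Union>n. A n)"
    using A_meas inc by (intro SUP_emeasure_incseq) (auto simp: N_def)
  ultimately have "ennreal \<eta> < (SUP n. emeasure N (A n))"
    using \<eta> False by (simp add: un ennreal_lessI)
  then obtain n where "ennreal \<eta> < emeasure N (A n)" by (auto simp: less_SUP_iff)
  then have "\<eta> < W (x + (d - x) / real (n + 2))" using False by (simp add: em ennreal_less_iff)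
  moreover have "x + (d - x) / real (n + 2) < d"
  proof -
    have "(d - x) / real (n + 2) < (d - x) / 1" using x by (intro divide_strict_left_mono) auto
    then show ?thesis by simp
  qed
  ultimately show ?thesis using x by (intro exI[of _ "x + (d - x) / real (n + 2)"]) auto
qed

section \<open>Discretisation by the levels of the profile\<close>

lemma lam_nonneg: "0 \<le> lam n"
  using F_nonneg[of d] cd by (simp add: lam_def)

lemma lam_Suc: "lam n = 4 * lam (Suc n)"
  by (simp add: lam_def)

lemma z_set: "z n \<in> {c..d}" and F_z: "F (z n) \<le> lam n"
proof -
  let ?S = "{x\<in>{c..d}. F x \<le> lam n}"
  have cS: "c \<in> ?S" using F_c lam_nonneg cd by simp
  have bdd: "bdd_above ?S" by (intro bdd_aboveI[of _ d]) auto
  have "c \<le> z n" unfolding z_def by (rule cSup_upper[OF cS bdd])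
  moreover have "z n \<le> d" unfolding z_def using cS by (intro cSup_least) auto
  ultimately show zs: "z n \<in> {c..d}" by simp
  show "F (z n) \<le> lam n"
  proof (cases "z n = c")
    case True
    then show ?thesis using F_c lam_nonneg by simp
  next
    case False
    show ?thesis
    proof (rule F_left)
      show "c < z n" "z n \<le> d" using zs False by auto
      fix y assume y: "c \<le> y" "y < z n"
      then obtain s where s: "s \<in> ?S" "y < s"
        using less_cSup_iff[OF _ bdd, of y] cS unfolding z_def by blast
      then show "F y \<le> lam n" using F_le[of y s] y by auto
    qed
  qed
qed

lemma le_z: "x \<in> {c..d} \<Longrightarrow> F x \<le> lam n \<Longrightarrow> x \<le> z n"
  unfolding z_def by (intro cSup_upper bdd_aboveI[of _ d]) auto

lemma less_z_iff: "x \<in> {c..d} \<Longrightarrow> z n < x \<longleftrightarrow> lam n < F x"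
  using le_z[of x n] F_z[of n] F_le[of x "z n"] z_set[of n] by force

lemma z_0: "z 0 = d"
  using le_z[of d 0] z_set[of 0] cd by (auto simp: lam_def)

lemma z_Suc_le: "z (Suc n) \<le> z n"
proof -
  have "F (z (Suc n)) \<le> lam n" using F_z[of "Suc n"] lam_Suc[of n] lam_nonneg[of "Suc n"] by linarith
  then show ?thesis using le_z z_set by blast
qed

text \<open>
  If \<open>z n < d\<close>, then immediately to the right of \<open>z n\<close> the profile \<open>F\<close> exceeds \<open>lam n\<close>,
  hence so does \<open>\<Phi>\<close>, and \<open>\<Phi>\<close> is right-continuous. For \<open>F\<close> in place of \<open>\<Phi>\<close> this can fail at jumps.
\<close>
lemma lam_le_\<Phi>_z: "lam n \<le> \<Phi> (z n)"
proof (cases "z n = d")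
  case True
  have "F d / 4 ^ n \<le> F d / 1" using F_nonneg[OF endpoints_mem(2)] by (intro divide_left_mono) auto
  then have "lam n \<le> F d" by (simp add: lam_def)
  then show ?thesis using True \<Phi>_d by simp
next
  case False
  then have lt: "c \<le> z n" "z n < d" using z_set[of n] by auto
  have "(\<Phi> \<longlongrightarrow> \<Phi> (z n)) (at_right (z n))" using \<Phi>_right[OF lt] by (simp add: continuous_within)
  moreover have "eventually (\<lambda>y. lam n \<le> \<Phi> y) (at_right (z n))"
    unfolding eventually_at_right_field
  proof (intro exI[of _ d] conjI allI impI lt)
    fix y assume y: "z n < y" "y < d"
    then show "lam n \<le> \<Phi> y" using less_z_iff[of y n] F_le_\<Phi>[of y] lt by auto
  qed
  ultimately show ?thesis by (rule tendsto_lowerbound) simp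
qed

lemma ex_level:
  assumes "0 < s" "s \<le> F d"
  shows "\<exists>n. lam (Suc n) < s \<and> s \<le> lam n"
proof -
  have lim: "(\<lambda>n. F d * (1 / 4) ^ n) \<longlonglongrightarrow> F d * 0"
    by (intro tendsto_intros LIMSEQ_power_zero) auto
  then have "eventually (\<lambda>n. F d * (1 / 4) ^ n < s) sequentially"
    using order_tendstoD(2)[OF lim, of s] assms by simp
  then obtain k where "F d * (1 / 4) ^ k < s"
    by (auto simp: eventually_sequentially)
  then have k: "lam k < s" by (simp add: lam_def power_divide)
  define m where "m = (LEAST k. lam k < s)"
  have m: "lam m < s" unfolding m_def by (rule LeastI[of "\<lambda>k. lam k < s", OF k])
  have "m \<noteq> 0" using m assms by (intro notI) (simp add: lam_def)
  then obtain n where n: "m = Suc n" by (cases m) auto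
  have "\<not> lam n < s" using not_less_Least[of n "\<lambda>k. lam k < s"] n by (auto simp: m_def)
  then show ?thesis using m n by auto
qed

section \<open>Upper bounds: sums over levels\<close>

lemma energy_indicator:
  "energy (\<lambda>t. h t * indicator A t) = (\<integral>\<^sup>+t. epowr (h t) p * v t * indicator A t \<partial>M)"
  unfolding energy_def using p by (simp add: epowr_indicator mult_ac)

text \<open>
  Hoelder's inequality on \<open>[c,b]\<close> applied to \<open>h\<close> restricted to \<open>(a,b]\<close>.
\<close>
lemma hoelder_piece:
  assumes h [measurable]: "h \<in> borel_measurable M" and fin: "energy h < \<infinity>"
    and ab: "c \<le> a" "a \<le> b" "b \<le> d"
  defines "e \<equiv> enn2real (\<integral>\<^sup>+t. epowr (h t) p * v t * indicator {a<..b} t \<partial>M)"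
  shows "(\<integral>\<^sup>+t. h t * indicator {a<..b} t \<partial>M) \<le> ennreal (2 * F b * e powr (1 / p))"
proof -
  let ?g = "\<lambda>t. h t * indicator {a<..b} t"
  have "energy ?g \<le> energy h"
    unfolding energy_indicator unfolding energy_def
    by (intro nn_integral_mono) (simp add: indicator_def)
  then have "energy ?g < \<infinity>" using fin by (rule le_less_trans)
  then have "(\<integral>\<^sup>+t. ?g t * indicator {c..b} t \<partial>M) \<le> ennreal (2 * F b * enn2real (energy ?g) powr (1 / p))"
    unfolding energy_def using ab by (intro hoelder) auto
  moreover have "(\<integral>\<^sup>+t. ?g t * indicator {c..b} t \<partial>M) = (\<integral>\<^sup>+t. ?g t \<partial>M)"
    using ab by (intro nn_integral_cong) (auto simp: indicator_def)
  ultimately show ?thesis by (simp add: e_def energy_indicator)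
qed

lemma H_le:
  assumes h: "h \<in> borel_measurable M" and fin: "energy h < \<infinity>" and x: "x \<in> {c..d}"
  shows "H h x \<le> ennreal (2 * F x * enn2real (energy h) powr (1 / p))"
  unfolding H_def energy_def using assms by (intro hoelder) (auto simp: energy_def)

text \<open>
  The sequence is \<open>x n = H h (z n) / lam n\<close>. Its sums of powers are bounded by the
  contraction from one level to the next, and the integral is bounded because \<open>H h\<close> is
  monotone, so that on \<open>(z (n + 1), z n]\<close> it is at most \<open>lam n * x n\<close>.
\<close>
lemma upper_discretization:
  assumes h [measurable]: "h \<in> borel_measurable M" and fin: "energy h < \<infinity>" and Fd: "0 < F d"
  obtains x :: "nat \<Rightarrow> real" where "\<And>n. 0 \<le> x n"
    and "\<And>N. (\<Sum>n<N. x n powr p) \<le> 2 * 4 powr p * enn2real (energy h)"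
    and "(\<integral>\<^sup>+y. epowr (H h y) q * w y \<partial>M) \<le> (\<Sum>n. ennreal ((lam n * x n) powr q * W (z (Suc n))))"
proof -
  define X where "X = enn2real (energy h)"
  define e where "e = (\<lambda>n. enn2real (\<integral>\<^sup>+t. epowr (h t) p * v t * indicator {z (Suc n)<..z n} t \<partial>M))"
  define Hz where "Hz = (\<lambda>n. enn2real (H h (z n)))"
  define x where "x = (\<lambda>n. Hz n / lam n)"
  have lam_pos: "0 < lam n" for n using Fd by (simp add: lam_def)
  have X0: "0 \<le> X" by (simp add: X_def)
  have e0: "0 \<le> e n" for n by (simp add: e_def)
  have [measurable]: "(indicator {z (Suc n)<..z n} :: real \<Rightarrow> ennreal) \<in> borel_measurable M" for n
    by (rule indicator_meas) auto
  have piece_fin: "(\<integral>\<^sup>+t. epowr (h t) p * v t * indicator {z (Suc n)<..z n} t \<partial>M) = ennreal (e n)" for n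
  proof -
    have "(\<integral>\<^sup>+t. epowr (h t) p * v t * indicator {z (Suc n)<..z n} t \<partial>M) \<le> energy h"
      unfolding energy_def by (intro nn_integral_mono) (simp add: indicator_def)
    then have "(\<integral>\<^sup>+t. epowr (h t) p * v t * indicator {z (Suc n)<..z n} t \<partial>M) < \<infinity>"
      using fin by (rule le_less_trans)
    then show ?thesis unfolding e_def by (simp add: ennreal_enn2real_if top.not_eq_extremum)
  qed
  have H_fin: "H h (z n) = ennreal (Hz n)" for n
    using le_less_trans[OF H_le[OF h fin z_set[of n]] ennreal_less_top] unfolding Hz_def
    by (simp add: ennreal_enn2real_if)
  have Hz0: "0 \<le> Hz n" for n by (simp add: Hz_def)
  have x0: "0 \<le> x n" for n using Hz0[of n] lam_pos[of n] by (simp add: x_def)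
  have Hz_le: "Hz n \<le> 2 * lam n * X powr (1 / p)" for n
  proof -
    have "Hz n \<le> 2 * F (z n) * X powr (1 / p)"
      using H_le[OF h fin z_set[of n]] F_nonneg[OF z_set[of n]] unfolding H_fin X_def
      by (simp add: ennreal_le_iff)
    also have "\<dots> \<le> 2 * lam n * X powr (1 / p)"
      using F_z[of n] by (intro mult_right_mono mult_left_mono) auto
    finally show ?thesis .
  qed
  \<comment> \<open>The factor obtained is \<open>1 / 4\<close>; \<open>1 / 2\<close> is what \<open>geometric_hardy\<close> needs.\<close>
  have rec: "x n \<le> x (Suc n) / 2 + 2 * e n powr (1 / p)" for n
  proof -
    have "H h (z n) = H h (z (Suc n)) + (\<integral>\<^sup>+t. h t * indicator {z (Suc n)<..z n} t \<partial>M)"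
    proof -
      have [measurable]: "(indicator {c..z (Suc n)} :: real \<Rightarrow> ennreal) \<in> borel_measurable M"
        by (rule indicator_meas) auto
      have "H h (z n) = (\<integral>\<^sup>+t. h t * indicator {c..z (Suc n)} t + h t * indicator {z (Suc n)<..z n} t \<partial>M)"
        unfolding H_def using z_Suc_le[of n] z_set[of n] z_set[of "Suc n"]
        by (intro nn_integral_cong) (auto simp: indicator_def)
      then show ?thesis unfolding H_def by (simp add: nn_integral_add)
    qed
    also have "\<dots> \<le> ennreal (Hz (Suc n)) + ennreal (2 * F (z n) * e n powr (1 / p))"
      unfolding H_fin e_def using z_Suc_le[of n] z_set[of n] z_set[of "Suc n"]
      by (intro add_mono order_refl hoelder_piece h fin) auto
    also have "\<dots> = ennreal (Hz (Suc n) + 2 * F (z n) * e n powr (1 / p))"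
      using Hz0[of "Suc n"] F_nonneg[OF z_set[of n]] by (intro ennreal_plus[symmetric]) auto
    finally have "Hz n \<le> Hz (Suc n) + 2 * F (z n) * e n powr (1 / p)"
      unfolding H_fin using Hz0[of "Suc n"] F_nonneg[OF z_set[of n]] by (subst (asm) ennreal_le_iff) auto
    also have "\<dots> \<le> Hz (Suc n) + 2 * lam n * e n powr (1 / p)"
      using F_z[of n] by (intro add_mono mult_right_mono mult_left_mono) auto
    finally have "x n \<le> (Hz (Suc n) + 2 * lam n * e n powr (1 / p)) / lam n"
      unfolding x_def using lam_pos[of n] by (intro divide_right_mono) auto
    also have "\<dots> = x (Suc n) / 4 + 2 * e n powr (1 / p)"
      using lam_pos[of "Suc n"] unfolding x_def lam_Suc[of n] by (simp add: field_simps)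
    also have "x (Suc n) / 4 \<le> x (Suc n) / 2" using x0[of "Suc n"] by simp
    finally show ?thesis by simp
  qed
  have sum_e: "(\<Sum>n<N. e n) \<le> X" for N
  proof -
    have split: "(\<Sum>n<N. indicator {z (Suc n)<..z n} t :: ennreal) = indicator {z N<..d} t" if "t \<in> {c..d}" for t
    proof (induction N)
      case 0
      then show ?case using that by (simp add: z_0)
    next
      case (Suc N)
      have "z N \<le> d" using z_set[of N] by simp
      then show ?case using Suc z_Suc_le[of N] by (simp add: indicator_def)
    qed
    have "ennreal (\<Sum>n<N. e n) = (\<integral>\<^sup>+t. (\<Sum>n<N. epowr (h t) p * v t * indicator {z (Suc n)<..z n} t) \<partial>M)"
      using e0 by (subst nn_integral_sum) (auto simp: piece_fin sum_ennreal)
    also have "\<dots> \<le> energy h"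
      unfolding energy_def
    proof (intro nn_integral_mono)
      fix t assume "t \<in> space M"
      then show "(\<Sum>n<N. epowr (h t) p * v t * indicator {z (Suc n)<..z n} t) \<le> epowr (h t) p * v t"
        using split[of t] by (simp add: sum_distrib_left[symmetric] indicator_def)
    qed
    also have "\<dots> = ennreal X" using fin unfolding X_def by (simp add: ennreal_enn2real_if top.not_eq_extremum)
    finally show ?thesis using X0 by (simp add: ennreal_le_iff)
  qed
  have sum_x: "(\<Sum>n<N. x n powr p) \<le> 2 * 4 powr p * X" for N
  proof -
    \<comment> \<open>The boundary term of \<open>geometric_hardy\<close> is controlled by Hoelder's inequality on \<open>[c, z N]\<close>.\<close>
    have "x N \<le> 2 * X powr (1 / p)"
      using Hz_le[of N] lam_pos[of N] by (simp add: x_def divide_le_eq mult_ac)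
    then have "x N powr p \<le> (2 * X powr (1 / p)) powr p" using x0 p by (intro powr_mono2) auto
    also have "\<dots> = 2 powr p * X" using X0 p by (simp add: powr_mult powr_powr)
    also have "\<dots> \<le> 4 powr p * X" using X0 p by (intro mult_right_mono powr_mono2) auto
    finally have xN: "x N powr p \<le> 4 powr p * X" .
    have "(\<Sum>n<N. x n powr p) \<le> x N powr p + 2 powr p * (\<Sum>n<N. (2 * e n powr (1 / p)) powr p)"
      using rec x0 p e0 by (intro geometric_hardy) auto
    also have "(\<Sum>n<N. (2 * e n powr (1 / p)) powr p) = 2 powr p * (\<Sum>n<N. e n)"
      using e0 p by (simp add: powr_mult powr_powr sum_distrib_left)
    also have "2 powr p * (2 powr p * (\<Sum>n<N. e n)) = 4 powr p * (\<Sum>n<N. e n)"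
      by (simp add: powr_mult[symmetric] mult.assoc[symmetric])
    also have "\<dots> \<le> 4 powr p * X" using sum_e[of N] by (intro mult_left_mono) auto
    finally show ?thesis using xN by simp
  qed
  have point: "epowr (H h y) q \<le> (\<Sum>n. ennreal (Hz n powr q) * indicator {z (Suc n)<..z n} y)"
    if y: "y \<in> {c..d}" for y
  proof (cases "F y = 0")
    case True
    then have "H h y = 0" using H_le[OF h fin y] by simp
    then show ?thesis using q by simp
  next
    case False
    then have "0 < F y" using F_nonneg[OF y] by simp
    then obtain n where n: "lam (Suc n) < F y" "F y \<le> lam n"
      using ex_level[of "F y"] F_le[of y d] y by auto
    then have yn: "z (Suc n) < y" "y \<le> z n" using less_z_iff[OF y] le_z[OF y] by auto
    have "H h y \<le> H h (z n)"
      unfolding H_def using yn by (intro nn_integral_mono) (auto simp: indicator_def)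
    then have "epowr (H h y) q \<le> ennreal (Hz n powr q)"
      using epowr_mono[OF q, of "H h y" "H h (z n)"] H_fin[of n] Hz0[of n] q
      by (simp add: epowr_ennreal_pos)
    also have "\<dots> = (\<Sum>k\<in>{n}. ennreal (Hz k powr q) * indicator {z (Suc k)<..z k} y)"
      using yn by simp
    also have "\<dots> \<le> (\<Sum>k. ennreal (Hz k powr q) * indicator {z (Suc k)<..z k} y)"
      by (intro sum_le_suminf) auto
    finally show ?thesis .
  qed
  have "(\<integral>\<^sup>+y. epowr (H h y) q * w y \<partial>M)
      \<le> (\<integral>\<^sup>+y. (\<Sum>n. ennreal (Hz n powr q) * (w y * indicator {z (Suc n)<..z n} y)) \<partial>M)"
  proof (intro nn_integral_mono)
    fix y assume "y \<in> space M"
    then have "epowr (H h y) q * w y \<le> (\<Sum>n. ennreal (Hz n powr q) * indicator {z (Suc n)<..z n} y) * w y"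
      by (intro mult_right_mono point) auto
    also have "\<dots> = (\<Sum>n. ennreal (Hz n powr q) * (w y * indicator {z (Suc n)<..z n} y))"
      by (subst ennreal_suminf_multc[symmetric]) (simp add: mult_ac)
    finally show "epowr (H h y) q * w y \<le> \<dots>" .
  qed
  also have "\<dots> = (\<Sum>n. ennreal (Hz n powr q) * (\<integral>\<^sup>+y. w y * indicator {z (Suc n)<..z n} y \<partial>M))"
    by (subst nn_integral_suminf) (auto simp: nn_integral_cmult)
  also have "\<dots> \<le> (\<Sum>n. ennreal ((lam n * x n) powr q * W (z (Suc n))))"
  proof (intro suminf_le)
    fix n
    have "(\<integral>\<^sup>+y. w y * indicator {z (Suc n)<..z n} y \<partial>M) \<le> ennreal (W (z (Suc n)))"
      unfolding W_ennreal[symmetric]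
    proof (intro nn_integral_mono)
      fix y assume "y \<in> space M"
      then show "w y * indicator {z (Suc n)<..z n} y \<le> w y * indicator {z (Suc n)..d} y"
        by (auto simp: indicator_def)
    qed
    then have "ennreal (Hz n powr q) * (\<integral>\<^sup>+y. w y * indicator {z (Suc n)<..z n} y \<partial>M)
        \<le> ennreal (Hz n powr q) * ennreal (W (z (Suc n)))"
      by (intro mult_left_mono) auto
    moreover have "lam n * x n = Hz n" using lam_pos[of n] by (simp add: x_def)
    ultimately show "ennreal (Hz n powr q) * (\<integral>\<^sup>+y. w y * indicator {z (Suc n)<..z n} y \<partial>M)
        \<le> ennreal ((lam n * x n) powr q * W (z (Suc n)))"
      by (simp add: ennreal_mult' )
  qed auto
  finally show thesis using that[of x] x0 sum_x unfolding X_def by blast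
qed

text \<open>
  Reduction of an upper bound for the operator to one for finite sums over levels.
\<close>
lemma admissible_from_sums:
  assumes L: "0 \<le> L"
    and bound: "\<And>N X (x :: nat \<Rightarrow> real). 0 < F d \<Longrightarrow> 0 \<le> X \<Longrightarrow> (\<And>n. 0 \<le> x n) \<Longrightarrow>
      (\<Sum>n<N. x n powr p) \<le> 2 * 4 powr p * X \<Longrightarrow>
      (\<Sum>n<N. (lam n * x n) powr q * W (z (Suc n))) \<le> (L * X powr (1 / p)) powr q"
  shows "admissible L"
  unfolding admissible_def
proof (intro conjI ballI impI L)
  fix h assume h: "h \<in> borel_measurable M" and fin: "energy h < \<infinity>"
  let ?X = "enn2real (energy h)"
  show "(\<integral>\<^sup>+x. epowr (H h x) q * w x \<partial>M) \<le> ennreal ((L * ?X powr (1 / p)) powr q)"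
  proof (cases "F d = 0")
    case True
    have "H h x = 0" if "x \<in> {c..d}" for x
    proof -
      have "F x = 0" using F_nonneg[OF that] F_le[of x d] that True by auto
      then show ?thesis using H_le[OF h fin that] by simp
    qed
    then have "(\<integral>\<^sup>+x. epowr (H h x) q * w x \<partial>M) = (\<integral>\<^sup>+x. 0 \<partial>M)"
      using q by (intro nn_integral_cong) auto
    then show ?thesis by simp
  next
    case False
    then have Fd: "0 < F d" using F_nonneg[of d] cd by simp
    from upper_discretization[OF h fin Fd] obtain x :: "nat \<Rightarrow> real" where
      x: "\<And>n. 0 \<le> x n" "\<And>N. (\<Sum>n<N. x n powr p) \<le> 2 * 4 powr p * ?X"
      and le: "(\<integral>\<^sup>+y. epowr (H h y) q * w y \<partial>M) \<le> (\<Sum>n. ennreal ((lam n * x n) powr q * W (z (Suc n))))"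
      by blast
    note le
    also have "(\<Sum>n. ennreal ((lam n * x n) powr q * W (z (Suc n)))) \<le> ennreal ((L * ?X powr (1 / p)) powr q)"
      unfolding suminf_eq_SUP
    proof (rule SUP_least)
      fix N
      have "(\<Sum>n<N. (lam n * x n) powr q * W (z (Suc n))) \<le> (L * ?X powr (1 / p)) powr q"
        using Fd x by (intro bound) auto
      then show "(\<Sum>n<N. ennreal ((lam n * x n) powr q * W (z (Suc n)))) \<le> ennreal ((L * ?X powr (1 / p)) powr q)"
        using W_nonneg by (simp add: sum_ennreal ennreal_leI)
    qed
    finally show ?thesis .
  qed
qed

text \<open>
  By \<open>lam_le_\<Phi>_z\<close> the bound on \<open>\<Phi> * W powr (1 / q)\<close> applies with \<open>lam (n + 1)\<close> in place of \<open>\<Phi> (z (n + 1))\<close>,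
  and the level \<open>lam n\<close> is larger by the factor 4 only.
\<close>
lemma admissible_le_case:
  assumes pq: "p \<le> q" and A: "0 \<le> A" "\<And>x. x \<in> {c..d} \<Longrightarrow> \<Phi> x * W x powr (1 / q) \<le> A"
  shows "admissible (4 * (2 * 4 powr p) powr (1 / p) * A)"
proof (rule admissible_from_sums)
  fix N :: nat and X :: real and x :: "nat \<Rightarrow> real"
  assume X: "0 \<le> X" and x: "\<And>n. 0 \<le> x n" and S: "(\<Sum>n<N. x n powr p) \<le> 2 * 4 powr p * X"
  have "(lam n * x n) powr q * W (z (Suc n)) \<le> (4 * A) powr q * x n powr q" for n
  proof -
    let ?z = "z (Suc n)"
    have "lam (Suc n) * W ?z powr (1 / q) \<le> \<Phi> ?z * W ?z powr (1 / q)"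
      using lam_le_\<Phi>_z by (intro mult_right_mono) auto
    also have "\<dots> \<le> A" using A(2) z_set by blast
    finally have "lam n * W ?z powr (1 / q) \<le> 4 * A" by (simp add: lam_Suc[of n])
    then have "(lam n * W ?z powr (1 / q)) powr q \<le> (4 * A) powr q"
      using lam_nonneg[of n] q by (intro powr_mono2) auto
    then have "lam n powr q * W ?z \<le> (4 * A) powr q"
      using lam_nonneg[of n] W_nonneg[of ?z] q by (simp add: powr_mult powr_powr)
    then have "lam n powr q * W ?z * x n powr q \<le> (4 * A) powr q * x n powr q"
      by (intro mult_right_mono) auto
    then show ?thesis using lam_nonneg[of n] x[of n] by (simp add: powr_mult mult_ac)
  qed
  then have "(\<Sum>n<N. (lam n * x n) powr q * W (z (Suc n))) \<le> (\<Sum>n<N. (4 * A) powr q * x n powr q)"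
    by (intro sum_mono)
  also have "\<dots> = (4 * A) powr q * (\<Sum>n<N. x n powr q)" by (simp add: sum_distrib_left)
  also have "\<dots> \<le> (4 * A) powr q * (2 * 4 powr p * X) powr (q / p)"
    using p pq x S by (intro mult_left_mono sum_powr_le_powr_sum) auto
  also have "\<dots> = (4 * (2 * 4 powr p) powr (1 / p) * A * X powr (1 / p)) powr q"
  proof -
    have "(4 * A) powr q * (C * X) powr (q / p) = (4 * C powr (1 / p) * A * X powr (1 / p)) powr q"
      if "0 \<le> C" for C :: real
      using A(1) X p q that by (simp add: powr_mult powr_powr mult_ac)
    from this[of "2 * 4 powr p"] show ?thesis by simp
  qed
  finally show "(\<Sum>n<N. (lam n * x n) powr q * W (z (Suc n)))
      \<le> (4 * (2 * 4 powr p) powr (1 / p) * A * X powr (1 / p)) powr q" .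
qed (use A in simp)

text \<open>
  Hoelder's inequality with exponents \<open>p / q\<close> and \<open>r / q\<close>, which are conjugate by the choice of \<open>r\<close>.
\<close>
lemma admissible_lt_case:
  assumes qp: "q < p" and r: "1 / r = 1 / q - 1 / p" and A: "0 \<le> A"
    and G: "\<And>N. (\<Sum>n<N. lam (Suc n) powr r * W (z (Suc n)) powr (r / q)) \<le> B * A powr r" and B: "0 \<le> B"
  shows "admissible (4 * 2 powr (1 / q) * (2 * 4 powr p) powr (1 / p) * B powr (1 / r) * A)"
proof (rule admissible_from_sums)
  have r0: "0 < r" by (rule exponent_gap_pos[OF q qp r])
  have e1: "p / q / (p / q - 1) = r / q"
  proof -
    have "r * (p - q) = p * q" using r r0 p q by (simp add: field_simps)
    then show ?thesis using p q qp by (simp add: field_simps)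
  qed
  have e2: "q * (1 / r) = 1 - 1 / (p / q)" using r q p by (simp add: field_simps)
  fix N :: nat and X :: real and x :: "nat \<Rightarrow> real"
  assume X: "0 \<le> X" and x: "\<And>n. 0 \<le> x n" and S: "(\<Sum>n<N. x n powr p) \<le> 2 * 4 powr p * X"
  let ?g = "\<lambda>n. lam (Suc n) powr q * W (z (Suc n))"
  have "(lam n * x n) powr q * W (z (Suc n)) = 4 powr q * (x n powr q * ?g n)" for n
    unfolding lam_Suc[of n] using lam_nonneg x by (simp add: powr_mult mult_ac)
  then have "(\<Sum>n<N. (lam n * x n) powr q * W (z (Suc n))) = 4 powr q * (\<Sum>n<N. x n powr q * ?g n)"
    unfolding sum_distrib_left by (intro sum.cong refl)
  also have "(\<Sum>n<N. x n powr q * ?g n)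
      \<le> 2 * (2 * 4 powr p * X) powr (1 / (p / q)) * (B * A powr r) powr (1 - 1 / (p / q))"
  proof (rule sum_hoelder)
    show "1 < p / q" using qp q by simp
    show "(\<Sum>n<N. (x n powr q) powr (p / q)) \<le> 2 * 4 powr p * X" using S q by (simp add: powr_powr)
    have "(?g n) powr (r / q) = lam (Suc n) powr r * W (z (Suc n)) powr (r / q)" for n
      using lam_nonneg W_nonneg q by (simp add: powr_mult powr_powr)
    then show "(\<Sum>n<N. (?g n) powr (p / q / (p / q - 1))) \<le> B * A powr r" unfolding e1 using G by simp
  qed (use W_nonneg in auto)
  also have "4 powr q * (2 * (2 * 4 powr p * X) powr (1 / (p / q)) * (B * A powr r) powr (1 - 1 / (p / q)))
      = (4 * 2 powr (1 / q) * (2 * 4 powr p) powr (1 / p) * B powr (1 / r) * A * X powr (1 / p)) powr q"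
  proof -
    have 1: "(B * A powr r) powr (1 - 1 / (p / q)) = (B powr (1 / r) * A) powr q"
      unfolding e2[symmetric] using A B r0 by (simp add: powr_mult powr_powr mult_ac)
    have 2: "2 * s = (2 powr (1 / q)) powr q * s" for s :: real using q by (simp add: powr_powr)
    have "4 powr q * (2 * (C * X) powr (1 / (p / q)) * (B * A powr r) powr (1 - 1 / (p / q)))
        = (4 * 2 powr (1 / q) * C powr (1 / p) * B powr (1 / r) * A * X powr (1 / p)) powr q"
      if "0 \<le> C" for C
    proof -
      have "(C * X) powr (1 / (p / q)) = (C powr (1 / p) * X powr (1 / p)) powr q"
        using X q p that by (simp add: powr_mult powr_powr)
      then show ?thesis
        unfolding 1 2 using X A B that by (simp add: powr_mult mult_ac del: powr_powr)
    qed
    then show ?thesis by simp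
  qed
  finally show "(\<Sum>n<N. (lam n * x n) powr q * W (z (Suc n)))
      \<le> (4 * 2 powr (1 / q) * (2 * 4 powr p) powr (1 / p) * B powr (1 / r) * A * X powr (1 / p)) powr q"
    by simp
qed (use A B in simp)

section \<open>Lower bounds: test functions\<close>

lemma admissible_bound_F:
  assumes L: "admissible L" and x: "x \<in> {c..d}"
  shows "F x * W x powr (1 / q) \<le> L"
proof (rule dense_le)
  have L0: "0 \<le> L" using L by (simp add: admissible_def)
  fix s assume s: "s < F x * W x powr (1 / q)"
  show "s \<le> L"
  proof (cases "0 < s")
    case False
    then show ?thesis using L0 by simp
  next
    case True
    then have "W x \<noteq> 0" using s by auto
    then have W0: "0 < W x" using W_nonneg[of x] by simp
    define l where "l = s / W x powr (1 / q)"
    have l: "0 < l" "l < F x" using True s W0 by (auto simp: l_def field_simps)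
    obtain h where h: "h \<in> borel_measurable M" "1 \<le> (\<integral>\<^sup>+t. h t * indicator {c..x} t \<partial>M)"
      and E: "energy h \<le> ennreal (l powr - p)"
      using extremal[OF x l] unfolding energy_def by blast
    have fin: "energy h < \<infinity>" using le_less_trans[OF E ennreal_less_top] by simp
    have "ennreal (W x) = (\<integral>\<^sup>+t. w t * indicator {x..d} t \<partial>M)" by (simp add: W_ennreal)
    also have "\<dots> \<le> (\<integral>\<^sup>+t. epowr (H h t) q * w t \<partial>M)"
    proof (intro nn_integral_mono)
      fix t
      have "epowr 1 q \<le> epowr (H h t) q" if "x \<le> t"
      proof (rule epowr_mono[OF q])
        have "(\<integral>\<^sup>+t. h t * indicator {c..x} t \<partial>M) \<le> H h t"
          unfolding H_def using that by (intro nn_integral_mono) (auto simp: indicator_def)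
        then show "1 \<le> H h t" using h(2) by simp
      qed
      moreover have "epowr 1 q = 1" using epowr_ennreal_pos[of 1 q] q by simp
      ultimately show "w t * indicator {x..d} t \<le> epowr (H h t) q * w t"
        using mult_right_mono[of 1 "epowr (H h t) q" "w t"] by (auto simp: indicator_def)
    qed
    also have "\<dots> \<le> ennreal ((L * enn2real (energy h) powr (1 / p)) powr q)"
      using L h(1) fin by (auto simp: admissible_def)
    finally have "W x \<le> (L * enn2real (energy h) powr (1 / p)) powr q"
      by (simp add: ennreal_le_iff)
    also have "\<dots> \<le> (L / l) powr q"
    proof -
      have "enn2real (energy h) \<le> l powr - p" using E by (simp add: enn2real_leI)
      then have "enn2real (energy h) powr (1 / p) \<le> (l powr - p) powr (1 / p)"
        using p by (intro powr_mono2) auto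
      also have "\<dots> = 1 / l" unfolding powr_powr using p l by (simp add: powr_minus_divide)
      finally show ?thesis
        using L0 l q mult_left_mono[of _ "1 / l" L] by (intro powr_mono2) auto
    qed
    finally have W_le: "W x \<le> (L / l) powr q" .
    have "W x powr (1 / q) \<le> ((L / l) powr q) powr (1 / q)"
      using W_le W0 q by (intro powr_mono2) auto
    also have "\<dots> = L / l" using L0 l q by (simp add: powr_powr)
    finally show ?thesis using W0 l by (simp add: l_def field_simps)
  qed
qed

lemma admissible_bound_\<Phi>:
  assumes L: "admissible L" and x: "x \<in> {c..d}"
  shows "\<Phi> x * W x powr (1 / q) \<le> L"
proof (cases "x = d")
  case True
  then show ?thesis using admissible_bound_F[OF L x] \<Phi>_d by simp
next
  case False
  then have xd: "c \<le> x" "x < d" using x by auto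
  have L0: "0 \<le> L" using L by (simp add: admissible_def)
  \<comment> \<open>The point \<open>x\<close> is approached from the right, where \<open>\<Phi> x \<le> F y\<close>.\<close>
  show ?thesis
  proof (rule ccontr)
    assume "\<not> ?thesis"
    then have gt: "L < \<Phi> x * W x powr (1 / q)" by simp
    then have "\<Phi> x \<noteq> 0" using L0 by auto
    then have \<Phi>0: "0 < \<Phi> x" using \<Phi>_nonneg[OF x] by simp
    have "L / \<Phi> x < W x powr (1 / q)" using gt \<Phi>0 by (simp add: field_simps)
    then have "(L / \<Phi> x) powr q < (W x powr (1 / q)) powr q"
      using L0 \<Phi>0 q by (intro powr_less_mono2) auto
    also have "\<dots> = W x" using W_nonneg q by (simp add: powr_powr)
    finally obtain y where y: "x < y" "y < d" "(L / \<Phi> x) powr q < W y"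
      using W_right_continuous[OF xd] by blast
    have "((L / \<Phi> x) powr q) powr (1 / q) < W y powr (1 / q)"
      using y q by (intro powr_less_mono2) auto
    then have "L / \<Phi> x < W y powr (1 / q)" using L0 \<Phi>0 q by (simp add: powr_powr)
    then have "L < \<Phi> x * W y powr (1 / q)" using \<Phi>0 by (simp add: field_simps)
    also have "\<dots> \<le> F y * W y powr (1 / q)"
      using \<Phi>_le_F[of x y] xd y by (intro mult_right_mono) auto
    also have "\<dots> \<le> L" using admissible_bound_F[OF L, of y] xd y by auto
    finally show False by simp
  qed
qed

text \<open>
  The maximum of the functions \<open>b n * h n\<close>, where \<open>h n\<close> is extremal at \<open>y n\<close>: its \<open>p\<close>-th power is at most
  the sum of the \<open>p\<close>-th powers, and its mass up to \<open>y n\<close> is at least \<open>b n\<close>.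
\<close>
lemma test_function:
  fixes l b y :: "nat \<Rightarrow> real"
  assumes y: "\<And>n. n < N \<Longrightarrow> y n \<in> {c..d}" and l: "\<And>n. n < N \<Longrightarrow> 0 < l n \<and> l n < F (y n)"
    and b: "\<And>n. 0 \<le> b n"
  obtains h where "h \<in> borel_measurable M" "energy h \<le> ennreal (\<Sum>n<N. (b n / l n) powr p)"
    and "\<And>n t. n < N \<Longrightarrow> y n \<le> t \<Longrightarrow> ennreal (b n) \<le> H h t"
proof -
  have "\<exists>h. n < N \<longrightarrow> h \<in> borel_measurable M \<and> 1 \<le> (\<integral>\<^sup>+t. h t * indicator {c..y n} t \<partial>M) \<and>
      energy h \<le> ennreal (l n powr - p)" for n
    using extremal[OF y l[THEN conjunct1] l[THEN conjunct2], of n] unfolding energy_def by blast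
  then obtain f where f: "\<And>n. n < N \<Longrightarrow> f n \<in> borel_measurable M"
      "\<And>n. n < N \<Longrightarrow> 1 \<le> (\<integral>\<^sup>+t. f n t * indicator {c..y n} t \<partial>M)"
      "\<And>n. n < N \<Longrightarrow> energy (f n) \<le> ennreal (l n powr - p)"
    by metis
  define h where "h = (\<lambda>t. SUP n\<in>{..<N}. ennreal (b n) * f n t)"
  have hm: "h \<in> borel_measurable M"
    unfolding h_def using f(1) by (intro borel_measurable_SUP) auto
  have point: "epowr (h t) p \<le> (\<Sum>n<N. ennreal (b n powr p) * epowr (f n t) p)" for t
  proof (cases "N = 0")
    case True
    then show ?thesis using p by (simp add: h_def bot_ennreal)
  next
    case False
    have "h t = Max ((\<lambda>n. ennreal (b n) * f n t) ` {..<N})"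
      unfolding h_def using False by (intro cSup_eq_Max) auto
    also have "\<dots> \<in> (\<lambda>n. ennreal (b n) * f n t) ` {..<N}"
      using False by (intro Max_in) auto
    finally obtain n where n: "n < N" "h t = ennreal (b n) * f n t" by auto
    have "epowr (h t) p \<le> ennreal (b n powr p) * epowr (f n t) p"
    proof (cases "f n t")
      case (real s)
      then show ?thesis using n b[of n] p
        by (simp add: ennreal_mult[symmetric] epowr_ennreal_pos powr_mult)
    next
      case top
      then show ?thesis using n b[of n] p
        by (cases "b n = 0") (auto simp: ennreal_mult_top)
    qed
    also have "\<dots> \<le> (\<Sum>n<N. ennreal (b n powr p) * epowr (f n t) p)"
      using n by (intro member_le_sum) auto
    finally show ?thesis .
  qed
  have [measurable]: "n \<in> {..<N} \<Longrightarrow> f n \<in> borel_measurable M" for n using f(1) by simp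
  have "energy h \<le> (\<integral>\<^sup>+t. (\<Sum>n<N. ennreal (b n powr p) * (epowr (f n t) p * v t)) \<partial>M)"
    unfolding energy_def
  proof (intro nn_integral_mono)
    fix t
    have "epowr (h t) p * v t \<le> (\<Sum>n<N. ennreal (b n powr p) * epowr (f n t) p) * v t"
      by (intro mult_right_mono point) auto
    then show "epowr (h t) p * v t \<le> (\<Sum>n<N. ennreal (b n powr p) * (epowr (f n t) p * v t))"
      by (simp add: sum_distrib_right mult.assoc)
  qed
  also have "\<dots> = (\<Sum>n<N. ennreal (b n powr p) * energy (f n))"
    unfolding energy_def by (subst nn_integral_sum) (auto intro!: sum.cong nn_integral_cmult)
  also have "\<dots> \<le> (\<Sum>n<N. ennreal (b n powr p) * ennreal (l n powr - p))"
    using f(3) by (intro sum_mono mult_left_mono) auto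
  also have "\<dots> = (\<Sum>n<N. ennreal ((b n / l n) powr p))"
    using b l by (intro sum.cong refl)
      (auto simp: ennreal_mult'[symmetric] powr_divide powr_minus_divide less_imp_le)
  also have "\<dots> = ennreal (\<Sum>n<N. (b n / l n) powr p)" by (intro sum_ennreal) auto
  finally have E: "energy h \<le> ennreal (\<Sum>n<N. (b n / l n) powr p)" .
  have "ennreal (b n) \<le> H h t" if n: "n < N" and t: "y n \<le> t" for n t
  proof -
    have [measurable]: "f n \<in> borel_measurable M" using f(1) n by simp
    have [measurable]: "(indicator {c..y n} :: real \<Rightarrow> ennreal) \<in> borel_measurable M"
      by (rule indicator_meas) auto
    have "ennreal (b n) * 1 \<le> ennreal (b n) * (\<integral>\<^sup>+t. f n t * indicator {c..y n} t \<partial>M)"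
      using f(2)[OF n] by (intro mult_left_mono) auto
    also have "\<dots> = (\<integral>\<^sup>+t. ennreal (b n) * (f n t * indicator {c..y n} t) \<partial>M)"
      by (simp add: nn_integral_cmult)
    also have "\<dots> \<le> H h t"
      unfolding H_def
    proof (intro nn_integral_mono)
      fix s
      have "ennreal (b n) * f n s \<le> h s" unfolding h_def using n by (intro SUP_upper) auto
      then show "ennreal (b n) * (f n s * indicator {c..y n} s) \<le> h s * indicator {c..t} s"
        using t by (auto simp: indicator_def)
    qed
    finally show ?thesis by simp
  qed
  then show thesis using that hm E by blast
qed

text \<open>
  The numbers \<open>a n\<close> are the extremal choice when \<open>\<Sum> a\<^sub>n\<^sup>q W (y n)\<close> is bounded in terms of
  \<open>\<Sum> (a\<^sub>n / l n)\<^sup>p\<close> by Hoelder's inequality: both \<open>(a n / l n) powr p\<close> and \<open>a n powr q * W (y n)\<close> are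
  equal to the \<open>n\<close>-th summand \<open>l n powr r * W (y n) powr (r / q)\<close>. Replacing \<open>a\<close> by the larger \<open>b\<close>, which satisfies
  \<open>b n = a n + 2 * b (n + 1)\<close>, costs only a constant in the energy. With \<open>G\<close> for the sum, testing
  gives \<open>G \<le> C (2 L)\<^sup>q G\<^sup>q\<^sup>/\<^sup>p\<close>, and \<open>G\<^sup>q\<^sup>/\<^sup>p\<close> can be divided out since \<open>G\<close> is finite.
\<close>
lemma admissible_bound_sum:
  fixes l y :: "nat \<Rightarrow> real"
  assumes L: "admissible L" and qp: "q < p" and r: "1 / r = 1 / q - 1 / p"
    and y: "\<And>n. n < N \<Longrightarrow> y n \<in> {c..d}" and l: "\<And>n. n < N \<Longrightarrow> l n < F (y n)"
    and l0: "\<And>n. 0 < l n" and l4: "\<And>n. l n = 4 * l (Suc n)"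
  shows "(\<Sum>n<N. l n powr r * W (y n) powr (r / q)) \<le> (2 * (1 - 2 powr - q) powr (- 1 / q) * L) powr r"
proof -
  have L0: "0 \<le> L" using L by (simp add: admissible_def)
  have r0: "0 < r" by (rule exponent_gap_pos[OF q qp r])
  have rpq: "r * (p - q) = p * q" using r r0 p q by (simp add: field_simps)
  have e1: "r / q - 1 = r / p" using rpq p q by (simp add: field_simps)
  have e2: "q / r = 1 - q / p" using r q p by (simp add: field_simps)
  define C where "C = 1 / (1 - 2 powr - q)"
  have C0: "0 < C" using q powr_less_mono[of "- q" 0 2] by (simp add: C_def)
  define a where "a = (\<lambda>n. l n powr (r / q) * W (y n) powr (r / (p * q)))"
  define b where "b = (\<lambda>n. \<Sum>j\<in>{n..<N}. 2 ^ (j - n) * a j)"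
  define G where "G = (\<Sum>n<N. l n powr r * W (y n) powr (r / q))"
  have a0: "0 \<le> a n" for n by (simp add: a_def)
  have b0: "0 \<le> b n" for n unfolding b_def using a0 by (intro sum_nonneg) auto
  have bN: "b N = 0" by (simp add: b_def)
  have b_rec: "b n = a n + 2 * b (Suc n)" if "n < N" for n
  proof -
    have "b n = a n + (\<Sum>j\<in>{Suc n..<N}. 2 ^ (j - n) * a j)"
      using that by (simp add: b_def sum.atLeast_Suc_lessThan)
    also have "(\<Sum>j\<in>{Suc n..<N}. 2 ^ (j - n) * a j) = (\<Sum>j\<in>{Suc n..<N}. 2 * (2 ^ (j - Suc n) * a j))"
      by (intro sum.cong refl) (auto simp: Suc_diff_Suc[symmetric])
    finally show ?thesis by (simp add: b_def sum_distrib_left)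
  qed
  have "(\<Sum>n<N. (b n / l n) powr p) \<le> (b N / l N) powr p + 2 powr p * (\<Sum>n<N. (a n / l n) powr p)"
  proof (rule geometric_hardy[OF p])
    fix n assume "n < N"
    then have "b n / l n = a n / l n + 2 * b (Suc n) / (4 * l (Suc n))"
      using b_rec[of n] l4[of n] by (simp add: add_divide_distrib)
    then show "b n / l n \<le> b (Suc n) / l (Suc n) / 2 + a n / l n" by simp
  qed (use a0 b0 l0 in \<open>auto simp: less_imp_le\<close>)
  also have "(\<Sum>n<N. (a n / l n) powr p) = G"
    unfolding G_def
  proof (intro sum.cong refl)
    fix n
    have "(a n / l n) powr p = (l n powr (r / q - 1) * W (y n) powr (r / (p * q))) powr p"
      using l0[of n] by (simp add: a_def powr_diff)
    also have "\<dots> = l n powr r * W (y n) powr (r / q)"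
      unfolding e1 using p by (simp add: powr_mult powr_powr)
    finally show "(a n / l n) powr p = l n powr r * W (y n) powr (r / q)" .
  qed
  finally have energy_bound: "(\<Sum>n<N. (b n / l n) powr p) \<le> 2 powr p * G" using bN by simp
  have G0: "0 \<le> G" unfolding G_def by (intro sum_nonneg) auto
  obtain h where h: "h \<in> borel_measurable M" "energy h \<le> ennreal (\<Sum>n<N. (b n / l n) powr p)"
    and H: "\<And>n t. n < N \<Longrightarrow> y n \<le> t \<Longrightarrow> ennreal (b n) \<le> H h t"
    using test_function[of N y l b] y l l0 b0 by blast
  have E: "energy h \<le> ennreal (2 powr p * G)"
    using order_trans[OF h(2) ennreal_leI[OF energy_bound]] .
  then have fin: "energy h < \<infinity>" using le_less_trans[OF _ ennreal_less_top] by auto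
  have [measurable]: "(indicator {y n..d} :: real \<Rightarrow> ennreal) \<in> borel_measurable M" for n
    by (rule indicator_meas) auto
  have point: "(\<Sum>n<N. ennreal (b n powr q) * indicator {y n..d} t) \<le> ennreal C * epowr (H h t) q" for t
  proof (cases "\<exists>n<N. y n \<le> t")
    case False
    then have "(\<Sum>n<N. ennreal (b n powr q) * indicator {y n..d} t) = 0"
      by (intro sum.neutral) (auto simp: indicator_def)
    then show ?thesis by simp
  next
    case True
    \<comment> \<open>The largest coefficient among those switched on at \<open>t\<close>; all later indices are included, which only
      increases the sum.\<close>
    define m where "m = (LEAST n. n < N \<and> y n \<le> t)"
    have m: "m < N" "y m \<le> t" using LeastI_ex[OF True] unfolding m_def by auto
    have least: "\<not> y n \<le> t" if "n < m" for n
      using not_less_Least[of n "\<lambda>n. n < N \<and> y n \<le> t"] that m(1) unfolding m_def by auto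
    have "(\<Sum>n<N. ennreal (b n powr q) * indicator {y n..d} t)
        = (\<Sum>n\<in>{m..<N}. ennreal (b n powr q) * indicator {y n..d} t)"
      using least by (intro sum.mono_neutral_right) (auto simp: indicator_def not_le)
    also have "\<dots> \<le> (\<Sum>n\<in>{m..<N}. ennreal (b n powr q))"
      by (intro sum_mono) (auto simp: indicator_def)
    also have "\<dots> = ennreal (\<Sum>n\<in>{m..<N}. b n powr q)" by (intro sum_ennreal) auto
    also have "\<dots> \<le> ennreal (C * b m powr q)"
      using geometric_tail_sum[where q = q and b = b and N = N and m = m] q b0 b_rec a0 m bN
      by (intro ennreal_leI) (auto simp: C_def)
    also have "\<dots> = ennreal C * epowr (ennreal (b m)) q"
      using C0 b0[of m] q by (simp add: epowr_ennreal_pos ennreal_mult)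
    also have "\<dots> \<le> ennreal C * epowr (H h t) q"
      using H[OF m] q by (intro mult_left_mono epowr_mono) auto
    finally show ?thesis .
  qed
  have "G \<le> (\<Sum>n<N. b n powr q * W (y n))"
    unfolding G_def
  proof (intro sum_mono)
    fix n assume "n \<in> {..<N}"
    then have n: "n < N" by simp
    have "l n powr r * W (y n) powr (r / q) = l n powr r * (W (y n) powr (r / p) * W (y n))"
    proof (cases "W (y n) = 0")
      case False
      then have "0 < W (y n)" using W_nonneg[of "y n"] by simp
      then have "W (y n) powr (r / p + 1) = W (y n) powr (r / p) * W (y n)" by (simp add: powr_add)
      then show ?thesis using e1 by (simp add: algebra_simps)
    qed simp
    also have "\<dots> = a n powr q * W (y n)"
      using q by (simp add: a_def powr_mult powr_powr)
    also have "\<dots> \<le> b n powr q * W (y n)"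
      using b_rec[OF n] b0[of "Suc n"] a0[of n] q W_nonneg
      by (intro mult_right_mono powr_mono2) auto
    finally show "l n powr r * W (y n) powr (r / q) \<le> b n powr q * W (y n)" .
  qed
  then have "ennreal G \<le> ennreal (\<Sum>n<N. b n powr q * W (y n))" by (rule ennreal_leI)
  also have "\<dots> = (\<Sum>n<N. ennreal (b n powr q) * (\<integral>\<^sup>+t. w t * indicator {y n..d} t \<partial>M))"
    using W_nonneg by (subst sum_ennreal[symmetric]) (auto simp: W_ennreal ennreal_mult)
  also have "\<dots> = (\<integral>\<^sup>+t. (\<Sum>n<N. ennreal (b n powr q) * (w t * indicator {y n..d} t)) \<partial>M)"
    by (subst nn_integral_sum) (auto intro!: sum.cong nn_integral_cmult[symmetric])
  also have "\<dots> = ennreal C * (ennreal (1 / C) * (\<integral>\<^sup>+t. (\<Sum>n<N. ennreal (b n powr q) * (w t * indicator {y n..d} t)) \<partial>M))"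
    using C0 by (simp add: mult.assoc[symmetric] ennreal_mult[symmetric])
  also have "ennreal (1 / C) * (\<integral>\<^sup>+t. (\<Sum>n<N. ennreal (b n powr q) * (w t * indicator {y n..d} t)) \<partial>M)
      = (\<integral>\<^sup>+t. ennreal (1 / C) * (\<Sum>n<N. ennreal (b n powr q) * (w t * indicator {y n..d} t)) \<partial>M)"
    by (rule nn_integral_cmult[symmetric]) measurable
  also have "ennreal C * \<dots> \<le> ennreal C * (\<integral>\<^sup>+t. epowr (H h t) q * w t \<partial>M)"
  proof (intro mult_left_mono nn_integral_mono)
    fix t
    have "ennreal (1 / C) * (\<Sum>n<N. ennreal (b n powr q) * (w t * indicator {y n..d} t))
        = ennreal (1 / C) * ((\<Sum>n<N. ennreal (b n powr q) * indicator {y n..d} t) * w t)"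
      unfolding sum_distrib_right
      by (intro arg_cong[where f = "\<lambda>s. ennreal (1 / C) * s"] sum.cong refl) (simp only: mult_ac)
    also have "\<dots> \<le> ennreal (1 / C) * (ennreal C * epowr (H h t) q * w t)"
      by (intro mult_left_mono mult_right_mono point) auto
    also have "\<dots> = epowr (H h t) q * w t"
      using C0 by (simp add: mult.assoc[symmetric] ennreal_mult[symmetric])
    finally show "ennreal (1 / C) * (\<Sum>n<N. ennreal (b n powr q) * (w t * indicator {y n..d} t))
        \<le> epowr (H h t) q * w t" .
  qed auto
  also have "\<dots> \<le> ennreal C * ennreal ((L * enn2real (energy h) powr (1 / p)) powr q)"
    using L h(1) fin by (intro mult_left_mono) (auto simp: admissible_def)
  also have "\<dots> \<le> ennreal (C * (2 * L) powr q * G powr (q / p))"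
  proof -
    have "enn2real (energy h) \<le> 2 powr p * G" using E G0 by (intro enn2real_leI) auto
    then have "enn2real (energy h) powr (1 / p) \<le> (2 powr p * G) powr (1 / p)"
      using p by (intro powr_mono2) auto
    also have "\<dots> = 2 * G powr (1 / p)" using G0 p by (simp add: powr_mult powr_powr)
    finally have "(L * enn2real (energy h) powr (1 / p)) powr q \<le> (L * (2 * G powr (1 / p))) powr q"
      using L0 q by (intro powr_mono2 mult_left_mono) auto
    also have "\<dots> = (2 * L) powr q * G powr (q / p)"
      using L0 q by (simp add: powr_mult powr_powr mult_ac)
    finally show ?thesis using C0 by (simp add: ennreal_mult'[symmetric] mult.assoc ennreal_leI)
  qed
  finally have main: "G \<le> C * (2 * L) powr q * G powr (q / p)"
    using C0 by (simp add: ennreal_le_iff)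
  show ?thesis
  proof (cases "G = 0")
    case True
    then show ?thesis by (simp add: G_def[symmetric])
  next
    case False
    then have Gp: "0 < G" using G0 by simp
    have "G powr (q / r) = G / G powr (q / p)" unfolding e2 using Gp by (simp add: powr_diff)
    also have "\<dots> \<le> C * (2 * L) powr q" using main Gp by (simp add: divide_le_eq)
    finally have "(G powr (q / r)) powr (r / q) \<le> (C * (2 * L) powr q) powr (r / q)"
      using q r0 by (intro powr_mono2) auto
    moreover have "(G powr (q / r)) powr (r / q) = G" using Gp q r0 by (simp add: powr_powr)
    moreover have "(C * (2 * L) powr q) powr (r / q) = (2 * (1 - 2 powr - q) powr (- 1 / q) * L) powr r"
    proof -
      have "C powr (r / q) = ((1 - 2 powr - q) powr (- 1 / q)) powr r"
        using q by (simp add: C_def powr_powr powr_divide powr_minus_divide)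
      then show ?thesis using C0 L0 q by (simp add: powr_mult powr_powr mult_ac)
    qed
    ultimately show ?thesis by (simp add: G_def[symmetric])
  qed
qed

section \<open>The Stieltjes integral and the sum over levels\<close>

definition \<mu> :: "real \<Rightarrow> real measure" where
  "\<mu> r = stieltjes (\<lambda>x. \<Phi> x powr r) c d"

lemma space_\<mu> [simp]: "space (\<mu> r) = {c..d}"
  by (simp add: \<mu>_def stieltjes_def space_restrict_space)

lemma sets_\<mu>: "A \<in> sets borel \<Longrightarrow> A \<subseteq> {c..d} \<Longrightarrow> A \<in> sets (\<mu> r)"
  by (simp add: \<mu>_def stieltjes_def sets_restrict_space_iff)

lemma measurable_\<mu>: "f \<in> borel_measurable borel \<Longrightarrow> f \<in> borel_measurable (\<mu> r)"
  unfolding \<mu>_def stieltjes_def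
  by (intro measurable_restrict_space1) (simp add: measurable_def)

lemma emeasure_\<mu>_Icc:
  assumes r: "0 < r" and x: "x \<in> {c..d}"
  shows "emeasure (\<mu> r) {c..x} = ennreal (\<Phi> x powr r)"
  unfolding \<mu>_def
proof (rule emeasure_stieltjes_Icc[OF cd])
  show "mono_on {c..d} (\<lambda>x. \<Phi> x powr r)"
    using \<Phi>_le \<Phi>_nonneg r by (intro mono_onI powr_mono2) auto
  fix x assume x: "c \<le> x" "x < d"
  have "(\<Phi> \<longlongrightarrow> \<Phi> x) (at_right x)" using \<Phi>_right[OF x] by (simp add: continuous_within)
  moreover have "eventually (\<lambda>y. 0 \<le> \<Phi> y) (at_right x)"
    unfolding eventually_at_right_field using x \<Phi>_nonneg by (intro exI[of _ d]) auto
  ultimately show "continuous (at_right x) (\<lambda>x. \<Phi> x powr r)"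
    unfolding continuous_within using r by (intro tendsto_powr') auto
qed (use x in auto)

lemma emeasure_\<mu>_Ioc:
  assumes r: "0 < r" and ab: "c \<le> a" "a \<le> b" "b \<le> d"
  shows "emeasure (\<mu> r) {a<..b} = ennreal (\<Phi> b powr r - \<Phi> a powr r)"
proof -
  have "{a<..b} = {c..b} - {c..a}" using ab by auto
  then have "emeasure (\<mu> r) {a<..b} = emeasure (\<mu> r) ({c..b} - {c..a})" by simp
  also have "\<dots> = emeasure (\<mu> r) {c..b} - emeasure (\<mu> r) {c..a}"
    using ab r by (intro emeasure_Diff) (auto simp: emeasure_\<mu>_Icc intro!: sets_\<mu>)
  also have "\<dots> = ennreal (\<Phi> b powr r - \<Phi> a powr r)"
    using ab r by (simp add: emeasure_\<mu>_Icc ennreal_minus)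
  finally show ?thesis .
qed

text \<open>
  A sublevel set is an initial interval, closed or half-open. In the half-open case its
  measure is a limit of values of \<open>\<Phi>\<^sup>r\<close> from the left, and these do not exceed \<open>s\<^sup>r\<close> even if \<open>\<Phi>\<close> jumps at the
  end point.
\<close>
lemma sublevel_\<mu>:
  assumes r: "0 < r" and s: "0 \<le> s"
  defines "S \<equiv> {x\<in>{c..d}. \<Phi> x \<le> s}"
  shows "S \<in> sets (\<mu> r)" and "emeasure (\<mu> r) S \<le> ennreal (s powr r)"
proof -
  have "S \<in> sets (\<mu> r) \<and> emeasure (\<mu> r) S \<le> ennreal (s powr r)"
  proof (cases "S = {}")
    case False
    define t where "t = Sup S"
    have bdd: "bdd_above S" unfolding S_def by (intro bdd_aboveI[of _ d]) auto
    have le_t: "x \<le> t" if "x \<in> S" for x unfolding t_def using that bdd by (rule cSup_upper)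
    have td: "t \<le> d" unfolding t_def using False by (intro cSup_least) (auto simp: S_def)
    have down: "y \<in> S" if "c \<le> y" "y \<le> x" "x \<in> S" for x y
      using that \<Phi>_le[of y x] by (auto simp: S_def)
    show ?thesis
    proof (cases "t \<in> S")
      case True
      then have tc: "t \<in> {c..d}" "\<Phi> t \<le> s" by (auto simp: S_def)
      have "S = {c..t}"
      proof (intro equalityI subsetI)
        fix y assume "y \<in> S"
        then show "y \<in> {c..t}" using le_t[of y] by (simp add: S_def)
      next
        fix y assume "y \<in> {c..t}"
        then show "y \<in> S" using down[of y t] True by simp
      qed
      then show ?thesis
        using tc r \<Phi>_nonneg[of t] emeasure_\<mu>_Icc[OF r tc(1)]
        by (auto intro!: sets_\<mu> ennreal_leI powr_mono2)
    next
      case False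
      obtain x0 where x0: "x0 \<in> S" using \<open>S \<noteq> {}\<close> by auto
      have ct: "c < t"
      proof -
        have "x0 \<noteq> t" using x0 False by auto
        then show ?thesis using le_t[OF x0] x0 by (auto simp: S_def)
      qed
      have below: "y \<in> S" if cy: "c \<le> y" and yt: "y < t" for y
      proof -
        obtain x where "x \<in> S" "y < x"
          using yt less_cSup_iff[OF \<open>S \<noteq> {}\<close> bdd, of y] unfolding t_def by blast
        then show ?thesis using cy by (intro down[of y x]) auto
      qed
      define u where "u = (\<lambda>n. t - (t - c) / real (Suc n))"
      have u: "c \<le> u n" "u n < t" for n
      proof -
        have "(t - c) / real (Suc n) \<le> (t - c) / 1" using ct by (intro divide_left_mono) auto
        then show "c \<le> u n" by (simp add: u_def)
        show "u n < t" using ct by (simp add: u_def)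
      qed
      have inc: "incseq (\<lambda>n. {c..u n})"
      proof (rule incseq_SucI)
        fix n
        have "(t - c) / real (Suc (Suc n)) \<le> (t - c) / real (Suc n)"
          using ct by (intro divide_left_mono) auto
        then show "{c..u n} \<subseteq> {c..u (Suc n)}" by (auto simp: u_def)
      qed
      have eq: "S = (\<Union>n. {c..u n})"
      proof (intro equalityI subsetI)
        fix x assume x: "x \<in> S"
        then have "x < t" using le_t[OF x] False by (cases "x = t") auto
        then obtain n where "(t - c) / (t - x) < real n" using reals_Archimedean2 by blast
        then have "(t - c) / real (Suc n) \<le> t - x" using \<open>x < t\<close> by (auto simp: field_simps)
        then have "x \<in> {c..u n}" using x by (simp add: u_def S_def)
        then show "x \<in> (\<Union>n. {c..u n})" by blast
      next
        fix x assume "x \<in> (\<Union>n. {c..u n})"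
        then obtain n where "c \<le> x" "x \<le> u n" by auto
        then show "x \<in> S" using below[of x] u(2)[of n] by auto
      qed
      have meas: "{c..u n} \<in> sets (\<mu> r)" for n
        using u[of n] td by (intro sets_\<mu>) auto
      have "emeasure (\<mu> r) S = (SUP n. emeasure (\<mu> r) {c..u n})"
        unfolding eq using meas inc by (intro SUP_emeasure_incseq[symmetric]) auto
      also have "\<dots> \<le> ennreal (s powr r)"
      proof (rule SUP_least)
        fix n
        have un: "u n \<in> {c..d}" "\<Phi> (u n) \<le> s"
          using u[of n] td below[of "u n"] by (auto simp: S_def)
        then show "emeasure (\<mu> r) {c..u n} \<le> ennreal (s powr r)"
          unfolding emeasure_\<mu>_Icc[OF r un(1)] using r \<Phi>_nonneg[OF un(1)]
          by (intro ennreal_leI powr_mono2) auto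
      qed
      finally show ?thesis using meas unfolding eq by auto
    qed
  qed simp
  then show "S \<in> sets (\<mu> r)" "emeasure (\<mu> r) S \<le> ennreal (s powr r)" by auto
qed

definition profile_integral :: "real \<Rightarrow> ennreal" where
  "profile_integral r = (\<integral>\<^sup>+x. ennreal (W x powr (r / q)) \<partial>\<mu> r)"

lemma W_powr_measurable: "0 < r \<Longrightarrow> (\<lambda>x. ennreal (W x powr (r / q))) \<in> borel_measurable (\<mu> r)"
proof -
  have "(\<lambda>x. - W x) \<in> borel_measurable borel"
    using W_antimono by (intro borel_measurable_mono monoI) auto
  then have "(\<lambda>x. - (- W x)) \<in> borel_measurable borel" by (rule borel_measurable_uminus)
  then have [measurable]: "W \<in> borel_measurable borel" by simp
  show ?thesis by (rule measurable_\<mu>) measurable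
qed

lemma profile_integral_finite:
  assumes "0 < r" shows "profile_integral r < \<infinity>"
proof -
  have "profile_integral r \<le> (\<integral>\<^sup>+x. ennreal (W c powr (r / q)) \<partial>\<mu> r)"
    unfolding profile_integral_def using W_antimono W_nonneg q assms
    by (intro nn_integral_mono ennreal_leI powr_mono2) auto
  also have "\<dots> = ennreal (W c powr (r / q)) * emeasure (\<mu> r) {c..d}" by simp
  also have "\<dots> < \<infinity>" using assms endpoints_mem by (simp add: emeasure_\<mu>_Icc ennreal_mult_less_top)
  finally show ?thesis .
qed

text \<open>
  On the set where \<open>lam (n + 1) < \<Phi> \<le> lam n\<close> the argument is at least \<open>z (n + 1)\<close>, hence \<open>W\<close> is at
  most \<open>W (z (n + 1))\<close>, and the set has measure at most \<open>lam n powr r\<close>.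
\<close>
lemma profile_integral_le_sum:
  assumes r: "0 < r"
  shows "profile_integral r \<le> (\<Sum>n. ennreal (lam n powr r * W (z (Suc n)) powr (r / q)))"
proof -
  define S where "S = (\<lambda>s. {x\<in>{c..d}. \<Phi> x \<le> s})"
  define P where "P = (\<lambda>n. S (lam n) - S (lam (Suc n)))"
  have S_meas: "S s \<in> sets (\<mu> r)" and S_le: "emeasure (\<mu> r) (S s) \<le> ennreal (s powr r)" if "0 \<le> s" for s
    using sublevel_\<mu>[OF r that] by (auto simp: S_def)
  have [measurable]: "P n \<in> sets (\<mu> r)" for n
    unfolding P_def using S_meas lam_nonneg by auto
  have P_le: "emeasure (\<mu> r) (P n) \<le> ennreal (lam n powr r)" for n
  proof -
    have "emeasure (\<mu> r) (P n) \<le> emeasure (\<mu> r) (S (lam n))"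
      unfolding P_def using S_meas lam_nonneg by (intro emeasure_mono) auto
    also have "\<dots> \<le> ennreal (lam n powr r)" using S_le lam_nonneg by simp
    finally show ?thesis .
  qed
  have null: "S 0 \<in> null_sets (\<mu> r)" using S_meas[of 0] S_le[of 0] by (auto simp: null_sets_def)
  have point: "ennreal (W x powr (r / q)) \<le> (\<Sum>n. ennreal (W (z (Suc n)) powr (r / q)) * indicator (P n) x)"
    if x: "x \<in> {c..d}" "x \<notin> S 0" for x
  proof -
    have "0 < \<Phi> x" "\<Phi> x \<le> F d" using x \<Phi>_le[of x d] \<Phi>_d by (auto simp: S_def)
    then obtain n where n: "lam (Suc n) < \<Phi> x" "\<Phi> x \<le> lam n" using ex_level by blast
    have "z (Suc n) \<le> x"
    proof (rule ccontr)
      assume "\<not> z (Suc n) \<le> x"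
      then have "\<Phi> x \<le> F (z (Suc n))" using x z_set[of "Suc n"] by (intro \<Phi>_le_F) auto
      then show False using F_z[of "Suc n"] n by simp
    qed
    then have "W x powr (r / q) \<le> W (z (Suc n)) powr (r / q)"
      using W_antimono W_nonneg q r by (intro powr_mono2) auto
    then have "ennreal (W x powr (r / q)) \<le> ennreal (W (z (Suc n)) powr (r / q))" by (rule ennreal_leI)
    also have "\<dots> = (\<Sum>k\<in>{n}. ennreal (W (z (Suc k)) powr (r / q)) * indicator (P k) x)"
      using n x by (simp add: P_def S_def)
    also have "\<dots> \<le> (\<Sum>k. ennreal (W (z (Suc k)) powr (r / q)) * indicator (P k) x)"
      by (intro sum_le_suminf) auto
    finally show ?thesis .
  qed
  have "profile_integral r \<le> (\<integral>\<^sup>+x. (\<Sum>n. ennreal (W (z (Suc n)) powr (r / q)) * indicator (P n) x) \<partial>\<mu> r)"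
    unfolding profile_integral_def
  proof (rule nn_integral_mono_AE)
    show "AE x in \<mu> r. ennreal (W x powr (r / q)) \<le> (\<Sum>n. ennreal (W (z (Suc n)) powr (r / q)) * indicator (P n) x)"
      using point by (intro AE_I'[OF null]) auto
  qed
  also have "\<dots> = (\<Sum>n. ennreal (W (z (Suc n)) powr (r / q)) * emeasure (\<mu> r) (P n))"
    by (subst nn_integral_suminf) (auto simp: nn_integral_cmult)
  also have "\<dots> \<le> (\<Sum>n. ennreal (lam n powr r * W (z (Suc n)) powr (r / q)))"
  proof (intro suminf_le)
    fix n
    have "ennreal (W (z (Suc n)) powr (r / q)) * emeasure (\<mu> r) (P n)
        \<le> ennreal (W (z (Suc n)) powr (r / q)) * ennreal (lam n powr r)"
      using P_le by (intro mult_left_mono) auto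
    then show "ennreal (W (z (Suc n)) powr (r / q)) * emeasure (\<mu> r) (P n)
        \<le> ennreal (lam n powr r * W (z (Suc n)) powr (r / q))"
      by (simp add: ennreal_mult'[symmetric] mult.commute)
  qed auto
  finally show ?thesis .
qed

text \<open>
  Summation by parts along the points \<open>z N \<le> ... \<le> z 1\<close>. The measure of \<open>[c, z n]\<close> is
  \<open>\<Phi> (z n) powr r\<close>, which is at least, but for \<open>p = 1\<close> possibly much larger than, \<open>lam n powr r\<close>. The induction
  therefore carries the unused mass \<open>\<Phi> (z n) powr r - lam n powr r\<close> along; as \<open>W\<close> is decreasing,
  it is safe to count it with the value of \<open>W\<close> at the current point.
\<close>
lemma sum_le_profile_integral:
  assumes r: "0 < r"
  shows "ennreal ((1 - 4 powr - r) * (\<Sum>n<N. lam (Suc n) powr r * W (z (Suc n)) powr (r / q))) \<le> profile_integral r"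
proof -
  define g where "g = (\<lambda>x. W x powr (r / q))"
  define \<theta> where "\<theta> = 1 - (4::real) powr - r"
  have g0: "0 \<le> g x" for x by (simp add: g_def)
  have g_anti: "g y \<le> g x" if "x \<le> y" for x y
    unfolding g_def using that W_antimono W_nonneg q r by (intro powr_mono2) auto
  have g_meas: "(\<lambda>x. ennreal (g x)) \<in> borel_measurable (\<mu> r)"
    unfolding g_def by (rule W_powr_measurable[OF r])
  have \<theta>0: "0 \<le> \<theta>" using r powr_less_mono[of "- r" 0 4] by (simp add: \<theta>_def)
  have lam_r: "lam (Suc n) powr r = (1 - \<theta>) * lam n powr r" for n
    unfolding lam_Suc[of n] using lam_nonneg[of "Suc n"]
    by (simp add: \<theta>_def powr_mult powr_minus field_simps)
  have "ennreal (\<theta> * (\<Sum>n\<in>{m..<N}. lam n powr r * g (z n)) + (\<Phi> (z m) powr r - lam m powr r) * g (z m))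
      \<le> (\<integral>\<^sup>+x. ennreal (g x) * indicator {c..z m} x \<partial>\<mu> r)" if "m \<le> N" for m N
    using that
  proof (induction rule: inc_induct)
    case base
    have "ennreal ((\<Phi> (z N) powr r - lam N powr r) * g (z N)) \<le> ennreal (g (z N)) * ennreal (\<Phi> (z N) powr r)"
      using g0 by (simp add: ennreal_mult'[symmetric] ennreal_leI algebra_simps)
    also have "\<dots> = (\<integral>\<^sup>+x. ennreal (g (z N)) * indicator {c..z N} x \<partial>\<mu> r)"
      using z_set[of N] r by (subst nn_integral_cmult_indicator) (auto simp: emeasure_\<mu>_Icc intro!: sets_\<mu>)
    also have "\<dots> \<le> (\<integral>\<^sup>+x. ennreal (g x) * indicator {c..z N} x \<partial>\<mu> r)"
      using g_anti by (intro nn_integral_mono) (auto simp: indicator_def intro!: ennreal_leI)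
    finally show ?case by simp
  next
    case (step n)
    let ?z = "z (Suc n)" and ?S = "\<Sum>k\<in>{Suc n..<N}. lam k powr r * g (z k)"
    have zz: "c \<le> ?z" "?z \<le> z n" "z n \<le> d" using z_set[of n] z_set[of "Suc n"] z_Suc_le[of n] by auto
    have lam_le: "lam (Suc n) powr r \<le> \<Phi> ?z powr r"
      using lam_le_\<Phi>_z[of "Suc n"] lam_nonneg r by (intro powr_mono2) auto
    have \<Phi>_diff: "0 \<le> \<Phi> (z n) powr r - \<Phi> ?z powr r"
      using \<Phi>_le[OF zz] \<Phi>_nonneg[of ?z] zz r by (simp add: powr_mono2)
    have sets: "{c..?z} \<in> sets (\<mu> r)" "{?z<..z n} \<in> sets (\<mu> r)" using zz by (auto intro!: sets_\<mu>)
    have "\<theta> * (\<Sum>k\<in>{n..<N}. lam k powr r * g (z k)) + (\<Phi> (z n) powr r - lam n powr r) * g (z n)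
        = \<theta> * ?S + (\<Phi> ?z powr r - lam (Suc n) powr r) * g (z n) + (\<Phi> (z n) powr r - \<Phi> ?z powr r) * g (z n)"
    proof -
      have "(\<Sum>k\<in>{n..<N}. lam k powr r * g (z k)) = lam n powr r * g (z n) + ?S"
        using step by (simp add: sum.atLeast_Suc_lessThan)
      then show ?thesis by (simp only: lam_r) (simp add: algebra_simps)
    qed
    also have "\<dots> \<le> \<theta> * ?S + (\<Phi> ?z powr r - lam (Suc n) powr r) * g ?z + (\<Phi> (z n) powr r - \<Phi> ?z powr r) * g (z n)"
      using lam_le zz by (intro add_right_mono add_left_mono mult_left_mono g_anti) auto
    finally have "ennreal (\<theta> * (\<Sum>k\<in>{n..<N}. lam k powr r * g (z k)) + (\<Phi> (z n) powr r - lam n powr r) * g (z n))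
        \<le> ennreal (\<theta> * ?S + (\<Phi> ?z powr r - lam (Suc n) powr r) * g ?z + (\<Phi> (z n) powr r - \<Phi> ?z powr r) * g (z n))"
      by (rule ennreal_leI)
    also have "\<dots> = ennreal (\<theta> * ?S + (\<Phi> ?z powr r - lam (Suc n) powr r) * g ?z)
        + ennreal (g (z n)) * ennreal (\<Phi> (z n) powr r - \<Phi> ?z powr r)"
      using \<theta>0 g0 lam_le \<Phi>_diff lam_nonneg
      by (subst ennreal_plus) (auto simp: ennreal_mult'[symmetric] mult.commute intro!: add_nonneg_nonneg mult_nonneg_nonneg sum_nonneg)
    also have "\<dots> \<le> (\<integral>\<^sup>+x. ennreal (g x) * indicator {c..?z} x \<partial>\<mu> r) + (\<integral>\<^sup>+x. ennreal (g (z n)) * indicator {?z<..z n} x \<partial>\<mu> r)"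
      using step.IH sets(2) r zz by (intro add_mono) (auto simp: nn_integral_cmult_indicator emeasure_\<mu>_Ioc)
    also have "\<dots> = (\<integral>\<^sup>+x. ennreal (g x) * indicator {c..?z} x + ennreal (g (z n)) * indicator {?z<..z n} x \<partial>\<mu> r)"
      by (intro nn_integral_add[symmetric] borel_measurable_times_ennreal g_meas
          borel_measurable_const borel_measurable_indicator sets)
    also have "\<dots> \<le> (\<integral>\<^sup>+x. ennreal (g x) * indicator {c..z n} x \<partial>\<mu> r)"
      using zz g_anti by (intro nn_integral_mono) (auto simp: indicator_def intro!: ennreal_leI)
    finally show ?case .
  qed
  from this[of 1 "Suc N"]
  have "ennreal (\<theta> * (\<Sum>n\<in>{1..<Suc N}. lam n powr r * g (z n)) + (\<Phi> (z 1) powr r - lam 1 powr r) * g (z 1))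
      \<le> (\<integral>\<^sup>+x. ennreal (g x) * indicator {c..z 1} x \<partial>\<mu> r)" by simp
  moreover have "0 \<le> (\<Phi> (z 1) powr r - lam 1 powr r) * g (z 1)"
    using lam_le_\<Phi>_z[of 1] lam_nonneg[of 1] r g0 by (intro mult_nonneg_nonneg) (auto intro!: powr_mono2)
  moreover have "(\<Sum>n\<in>{1..<Suc N}. lam n powr r * g (z n)) = (\<Sum>n<N. lam (Suc n) powr r * g (z (Suc n)))"
    using sum.shift_bounds_Suc_ivl[of "\<lambda>n. lam n powr r * g (z n)" 0 N] by (simp add: lessThan_atLeast0)
  ultimately have "ennreal (\<theta> * (\<Sum>n<N. lam (Suc n) powr r * g (z (Suc n))))
      \<le> (\<integral>\<^sup>+x. ennreal (g x) * indicator {c..z 1} x \<partial>\<mu> r)"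
    by (elim order_trans[rotated]) (intro ennreal_leI, simp)
  also have "\<dots> \<le> profile_integral r"
    unfolding profile_integral_def by (intro nn_integral_mono) (simp add: indicator_def g_def)
  finally show ?thesis unfolding \<theta>_def g_def .
qed

lemma admissible_profile_integral:
  assumes qp: "q < p" and r: "1 / r = 1 / q - 1 / p"
  shows "admissible (4 * 2 powr (1 / q) * (2 * 4 powr p) powr (1 / p) * (1 / (1 - 4 powr - r)) powr (1 / r)
    * enn2real (profile_integral r) powr (1 / r))"
proof (rule admissible_lt_case[OF qp r])
  have r0: "0 < r" by (rule exponent_gap_pos[OF q qp r])
  let ?I = "enn2real (profile_integral r)"
  have \<theta>: "0 < 1 - (4::real) powr - r" using r0 powr_less_mono[of "- r" 0 4] by simp
  show "0 \<le> 1 / (1 - (4::real) powr - r)" using \<theta> by simp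
  fix N
  have "ennreal ((1 - 4 powr - r) * (\<Sum>n<N. lam (Suc n) powr r * W (z (Suc n)) powr (r / q))) \<le> ennreal ?I"
    using sum_le_profile_integral[OF r0, of N] profile_integral_finite[OF r0]
    by (simp add: ennreal_enn2real_if top.not_eq_extremum)
  then have "(1 - 4 powr - r) * (\<Sum>n<N. lam (Suc n) powr r * W (z (Suc n)) powr (r / q)) \<le> ?I"
    by (simp add: ennreal_le_iff)
  then show "(\<Sum>n<N. lam (Suc n) powr r * W (z (Suc n)) powr (r / q)) \<le> 1 / (1 - 4 powr - r) * (?I powr (1 / r)) powr r"
    using \<theta> r0 by (simp add: powr_powr field_simps)
qed simp

text \<open>
  The points \<open>z (n + 1)\<close> are moved to the right to points \<open>y n\<close> at which the profile is strictly
  above the level and \<open>W\<close> has lost at most the factor 2.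
\<close>
lemma profile_integral_le_admissible:
  assumes L: "admissible L" and qp: "q < p" and r: "1 / r = 1 / q - 1 / p"
  shows "profile_integral r \<le> ennreal ((4 * 2 powr (1 / q) * (2 * (1 - 2 powr - q) powr (- 1 / q)) * L) powr r)"
proof -
  have r0: "0 < r" by (rule exponent_gap_pos[OF q qp r])
  define K where "K = 2 * (1 - 2 powr - q) powr (- 1 / q)"
  have K0: "0 \<le> K" by (simp add: K_def)
  have L0: "0 \<le> L" using L by (simp add: admissible_def)
  have bound: "(\<Sum>n<N. lam n powr r * W (z (Suc n)) powr (r / q)) \<le> (4 * 2 powr (1 / q) * K * L) powr r" for N
  proof (cases "F d = 0")
    case True
    then show ?thesis by (simp add: lam_def)
  next
    case False
    then have Fd: "0 < F d" using F_nonneg[OF endpoints_mem(2)] by simp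
    then have lam_pos: "0 < lam n" for n by (simp add: lam_def)
    have "\<exists>y. z (Suc n) < y \<and> y < d \<and> W (z (Suc n)) / 2 \<le> W y" for n
    proof -
      have "F d / 4 ^ Suc n < F d / 1"
        using Fd one_less_power[of "4::real" "Suc n"] by (intro divide_strict_left_mono) auto
      then have "lam (Suc n) < F d" by (simp add: lam_def)
      then have zd: "c \<le> z (Suc n)" "z (Suc n) < d" using less_z_iff[OF endpoints_mem(2)] z_set[of "Suc n"] by auto
      show ?thesis
      proof (cases "W (z (Suc n)) = 0")
        case True
        then show ?thesis using dense[OF zd(2)] W_nonneg by auto
      next
        case False
        then have "W (z (Suc n)) / 2 < W (z (Suc n))" using W_nonneg[of "z (Suc n)"] by simp
        then show ?thesis using W_right_continuous[OF zd] less_imp_le by blast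
      qed
    qed
    then obtain y where y: "\<And>n. z (Suc n) < y n" "\<And>n. y n < d" "\<And>n. W (z (Suc n)) / 2 \<le> W (y n)"
      by metis
    have y_set: "y n \<in> {c..d}" for n using y(1,2)[of n] z_set[of "Suc n"] by auto
    have "lam n powr r * W (z (Suc n)) powr (r / q)
        \<le> (4 * 2 powr (1 / q)) powr r * (lam (Suc n) powr r * W (y n) powr (r / q))" for n
    proof -
      have "W (z (Suc n)) powr (r / q) \<le> (2 * W (y n)) powr (r / q)"
        using y(3)[of n] W_nonneg q r0 by (intro powr_mono2) auto
      then have "lam n powr r * W (z (Suc n)) powr (r / q) \<le> (4 * lam (Suc n)) powr r * (2 * W (y n)) powr (r / q)"
        unfolding lam_Suc[of n] by (intro mult_left_mono) auto
      also have "\<dots> = (4 * 2 powr (1 / q)) powr r * (lam (Suc n) powr r * W (y n) powr (r / q))"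
        using lam_nonneg W_nonneg by (simp add: powr_mult powr_powr)
      finally show ?thesis .
    qed
    then have "(\<Sum>n<N. lam n powr r * W (z (Suc n)) powr (r / q))
        \<le> (\<Sum>n<N. (4 * 2 powr (1 / q)) powr r * (lam (Suc n) powr r * W (y n) powr (r / q)))"
      by (intro sum_mono)
    also have "\<dots> = (4 * 2 powr (1 / q)) powr r * (\<Sum>n<N. lam (Suc n) powr r * W (y n) powr (r / q))"
      by (simp add: sum_distrib_left)
    also have "\<dots> \<le> (4 * 2 powr (1 / q)) powr r * (K * L) powr r"
    proof (intro mult_left_mono)
      show "(\<Sum>n<N. lam (Suc n) powr r * W (y n) powr (r / q)) \<le> (K * L) powr r"
        unfolding K_def
      proof (rule admissible_bound_sum[OF L qp r])
        show "lam (Suc n) < F (y n)" for n using less_z_iff[OF y_set] y(1) by blast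
      qed (rule y_set lam_pos lam_Suc)+
    qed simp
    also have "\<dots> = (4 * 2 powr (1 / q) * (K * L)) powr r"
      by (simp add: powr_mult)
    finally show ?thesis by (simp add: mult.assoc)
  qed
  note profile_integral_le_sum[OF r0]
  also have "(\<Sum>n. ennreal (lam n powr r * W (z (Suc n)) powr (r / q))) \<le> ennreal ((4 * 2 powr (1 / q) * K * L) powr r)"
    unfolding suminf_eq_SUP
    by (rule SUP_least) (use bound in \<open>auto simp: sum_ennreal intro!: ennreal_leI\<close>)
  finally show ?thesis unfolding K_def .
qed

section \<open>Equivalences for the optimal constant\<close>

lemma hardy_eq: "x \<in> {c..d} \<Longrightarrow> hardy c h x = H h x"
  unfolding hardy_def H_def by (intro set_nn_integral_lebesgue_on) auto

lemma tail_int_eq: "x \<in> {c..d} \<Longrightarrow> tail_int d w x = ennreal (W x)"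
  unfolding tail_int_def W_ennreal[symmetric] by (intro set_nn_integral_lebesgue_on) auto

lemma wnorm_energy: "wnorm p v c d h = epowr (energy h) (1 / p)"
  unfolding wnorm_def energy_def
  by (subst set_nn_integral_lebesgue_on[of _ c d]) (auto intro!: arg_cong2[where f = epowr] nn_integral_cong simp: indicator_def)

lemma wnorm_hardy: "wnorm q w c d (hardy c h) = epowr (\<integral>\<^sup>+x. epowr (H h x) q * w x \<partial>M) (1 / q)"
  unfolding wnorm_def
  by (subst set_nn_integral_lebesgue_on[of _ c d])
     (auto intro!: arg_cong2[where f = epowr] nn_integral_cong simp: indicator_def hardy_eq)

lemma wnorm_le_iff:
  assumes L: "0 \<le> L" and fin: "energy h < \<infinity>"
  shows "wnorm q w c d (hardy c h) \<le> ennreal L * wnorm p v c d h \<longleftrightarrow>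
    (\<integral>\<^sup>+x. epowr (H h x) q * w x \<partial>M) \<le> ennreal ((L * enn2real (energy h) powr (1 / p)) powr q)"
proof -
  have "energy h = ennreal (enn2real (energy h))"
    using fin by (simp add: ennreal_enn2real_if top.not_eq_extremum)
  then have "wnorm p v c d h = ennreal (enn2real (energy h) powr (1 / p))"
    unfolding wnorm_energy using epowr_ennreal_pos[of "enn2real (energy h)" "1 / p"] p by simp
  then have "ennreal L * wnorm p v c d h = ennreal (L * enn2real (energy h) powr (1 / p))"
    using L by (simp add: ennreal_mult)
  then show ?thesis
    unfolding wnorm_hardy using L q by (simp add: epowr_root_le_iff epowr_ennreal_pos)
qed

text \<open>
  The number \<open>L = 0\<close> may be excluded from the set defining the infimum by functions of infinite norm,
  so the bound is shown for \<open>L + e\<close>.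
\<close>
lemma opt_const_le:
  assumes "admissible L" shows "opt_const p q v w c d \<le> ennreal L"
proof (rule ennreal_le_epsilon)
  have L: "0 \<le> L" using assms by (simp add: admissible_def)
  fix e :: real assume e: "0 < e"
  have "wnorm q w c d (hardy c h) \<le> ennreal (L + e) * wnorm p v c d h" if h: "h \<in> borel_measurable M" for h
  proof (cases "energy h < \<infinity>")
    case True
    have "(\<integral>\<^sup>+x. epowr (H h x) q * w x \<partial>M) \<le> ennreal ((L * enn2real (energy h) powr (1 / p)) powr q)"
      using assms h True by (auto simp: admissible_def)
    then have "wnorm q w c d (hardy c h) \<le> ennreal L * wnorm p v c d h"
      using wnorm_le_iff[OF L True] by simp
    also have "\<dots> \<le> ennreal (L + e) * wnorm p v c d h"
      using e by (intro mult_right_mono ennreal_leI) auto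
    finally show ?thesis .
  next
    case False
    then have "energy h = top" by (cases "energy h") auto
    then have "wnorm p v c d h = top" unfolding wnorm_energy using p by simp
    then show ?thesis using L e by (simp add: ennreal_mult_top)
  qed
  then have "opt_const p q v w c d \<le> ennreal (L + e)"
    unfolding opt_const_def by (intro Inf_lower) blast
  then show "opt_const p q v w c d \<le> ennreal L + ennreal e" using L e by simp
qed

lemma le_opt_const:
  assumes "\<And>L. admissible L \<Longrightarrow> B \<le> ennreal L" shows "B \<le> opt_const p q v w c d"
  unfolding opt_const_def
proof (rule Inf_greatest, clarify)
  fix L assume L: "\<forall>h\<in>borel_measurable M. wnorm q w c d (hardy c h) \<le> L * wnorm p v c d h"
  show "B \<le> L"
  proof (cases L)
    case (real l)
    then have "admissible l" unfolding admissible_def using L wnorm_le_iff by auto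
    then show ?thesis using assms real by simp
  qed simp
qed

lemma hardy_A_le_equivalence:
  assumes prof: "\<forall>x\<in>{c..d}. profile p v c d x = ennreal (\<Phi> x)" and pq: "p \<le> q"
  shows "hardy_A_le p q v w c d \<le> opt_const p q v w c d"
    and "opt_const p q v w c d \<le> ennreal (4 * (2 * 4 powr p) powr (1 / p)) * hardy_A_le p q v w c d"
proof -
  let ?A = "hardy_A_le p q v w c d"
  have term_eq: "profile p v c d x * epowr (tail_int d w x) (1 / q) = ennreal (\<Phi> x * W x powr (1 / q))"
    if "x \<in> {c..d}" for x
    using that prof tail_int_eq W_nonneg \<Phi>_nonneg q by (simp add: epowr_ennreal_pos ennreal_mult)
  have A_eq: "?A = (SUP x\<in>{c..d}. ennreal (\<Phi> x * W x powr (1 / q)))"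
    unfolding hardy_A_le_def using term_eq by (intro SUP_cong) auto
  show "?A \<le> opt_const p q v w c d"
    unfolding A_eq using admissible_bound_\<Phi> by (intro le_opt_const SUP_least ennreal_leI) auto
  have "?A \<le> ennreal (\<Phi> d * W c powr (1 / q))"
    unfolding A_eq using \<Phi>_le W_antimono \<Phi>_nonneg W_nonneg q
    by (intro SUP_least ennreal_leI mult_mono powr_mono2) auto
  then obtain a where a: "0 \<le> a" "?A = ennreal a" by (cases ?A) (auto simp: top_unique)
  have "\<Phi> x * W x powr (1 / q) \<le> a" if "x \<in> {c..d}" for x
  proof -
    have "ennreal (\<Phi> x * W x powr (1 / q)) \<le> ?A" unfolding A_eq using that by (intro SUP_upper)
    then show ?thesis using a by (simp add: ennreal_le_iff)
  qed
  from opt_const_le[OF admissible_le_case[OF pq a(1) this]]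
  show "opt_const p q v w c d \<le> ennreal (4 * (2 * 4 powr p) powr (1 / p)) * ?A"
    using a by (simp add: ennreal_mult)
qed

lemma profile_measure_eq:
  assumes prof: "\<forall>x\<in>{c..d}. profile p v c d x = ennreal (\<Phi> x)" and r0: "0 < r"
  shows "profile_measure p r v c d = \<mu> r"
proof -
  have "(\<lambda>x. if x < c then 0 else enn2real (epowr (profile p v c d (min x d)) r))
      = (\<lambda>x. if x < c then 0 else \<Phi> (min x d) powr r)"
  proof
    fix x
    show "(if x < c then 0 else enn2real (epowr (profile p v c d (min x d)) r))
        = (if x < c then 0 else \<Phi> (min x d) powr r)"
    proof (cases "x < c")
      case False
      then have "min x d \<in> {c..d}" using cd by auto
      then have "profile p v c d (min x d) = ennreal (\<Phi> (min x d))" "0 \<le> \<Phi> (min x d)"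
        using prof \<Phi>_nonneg by blast+
      then show ?thesis using r0 by (simp add: epowr_ennreal_pos)
    qed simp
  qed
  then show ?thesis unfolding profile_measure_def \<mu>_def stieltjes_def by simp
qed

lemma tail_integral_eq:
  assumes r0: "0 < r" and A: "A \<subseteq> {c..d}"
  shows "(\<integral>\<^sup>+x\<in>A. epowr (tail_int d w x) (r / q) \<partial>\<mu> r) = (\<integral>\<^sup>+x\<in>A. ennreal (W x powr (r / q)) \<partial>\<mu> r)"
proof (intro nn_integral_cong)
  fix x
  show "epowr (tail_int d w x) (r / q) * indicator A x = ennreal (W x powr (r / q)) * indicator A x"
  proof (cases "x \<in> A")
    case True
    then have "tail_int d w x = ennreal (W x)" using A by (intro tail_int_eq) auto
    then show ?thesis using q r0 W_nonneg by (simp add: epowr_ennreal_pos)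
  qed simp
qed

lemma hardy_A_lt_eq:
  assumes prof: "\<forall>x\<in>{c..d}. profile p v c d x = ennreal (\<Phi> x)" and r0: "0 < r"
  shows "hardy_A_lt p q r v w c d = epowr (profile_integral r) (1 / r)"
proof -
  have "(\<integral>\<^sup>+x\<in>{c..d}. ennreal (W x powr (r / q)) \<partial>\<mu> r) = profile_integral r"
    unfolding profile_integral_def by (intro nn_integral_cong) auto
  then show ?thesis
    unfolding hardy_A_lt_def profile_measure_eq[OF prof r0] by (simp add: tail_integral_eq[OF r0])
qed

lemma hardy_A_lt_equivalence:
  assumes prof: "\<forall>x\<in>{c..d}. profile p v c d x = ennreal (\<Phi> x)"
    and qp: "q < p" and r: "1 / r = 1 / q - 1 / p"
  shows "hardy_A_lt p q r v w c d
      \<le> ennreal (4 * 2 powr (1 / q) * (2 * (1 - 2 powr - q) powr (- 1 / q))) * opt_const p q v w c d"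
    and "opt_const p q v w c d
      \<le> ennreal (4 * 2 powr (1 / q) * (2 * 4 powr p) powr (1 / p) * (1 / (1 - 4 powr - r)) powr (1 / r))
        * hardy_A_lt p q r v w c d"
proof -
  have r0: "0 < r" by (rule exponent_gap_pos[OF q qp r])
  define a where "a = enn2real (profile_integral r)"
  define K where "K = 4 * 2 powr (1 / q) * (2 * (1 - 2 powr - q) powr (- 1 / q))"
  have K0: "0 < K" using powr_less_mono[of "- q" 0 2] q by (simp add: K_def)
  have a: "0 \<le> a" "profile_integral r = ennreal a"
    using profile_integral_finite[OF r0] by (auto simp: a_def ennreal_enn2real_if top.not_eq_extremum)
  have A: "hardy_A_lt p q r v w c d = ennreal (a powr (1 / r))"
    unfolding hardy_A_lt_eq[OF prof r0] a(2) using a(1) r0 by (simp add: epowr_ennreal_pos)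
  have "ennreal (a powr (1 / r) / K) \<le> opt_const p q v w c d"
  proof (rule le_opt_const)
    fix L assume L: "admissible L"
    then have L0: "0 \<le> L" by (simp add: admissible_def)
    have "a \<le> (K * L) powr r"
      using profile_integral_le_admissible[OF L qp r] by (simp add: a K_def ennreal_le_iff)
    then have "a powr (1 / r) \<le> ((K * L) powr r) powr (1 / r)" using a r0 by (intro powr_mono2) auto
    also have "\<dots> = K * L" using K0 L0 r0 by (simp add: powr_powr)
    finally show "ennreal (a powr (1 / r) / K) \<le> ennreal L"
      using K0 by (intro ennreal_leI) (simp add: divide_le_eq mult.commute)
  qed
  then have "ennreal K * ennreal (a powr (1 / r) / K) \<le> ennreal K * opt_const p q v w c d"
    by (rule mult_left_mono) simp
  then show "hardy_A_lt p q r v w c d \<le> ennreal K * opt_const p q v w c d"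
    using K0 by (simp add: A ennreal_mult[symmetric])
  show "opt_const p q v w c d
      \<le> ennreal (4 * 2 powr (1 / q) * (2 * 4 powr p) powr (1 / p) * (1 / (1 - 4 powr - r)) powr (1 / r))
        * hardy_A_lt p q r v w c d"
    using opt_const_le[OF admissible_profile_integral[OF qp r]]
    by (simp add: A a_def[symmetric] ennreal_mult')
qed

lemma atom_at_left_endpoint:
  assumes prof: "\<forall>x\<in>{c..d}. profile p v c d x = ennreal (\<Phi> x)" and r0: "0 < r"
  shows "(\<integral>\<^sup>+x\<in>{c..d}. epowr (tail_int d w x) (r / q) \<partial>profile_measure p r v c d) =
    epowr (tail_int d w c) (r / q) * epowr (profile p v c d c) r +
    (\<integral>\<^sup>+x\<in>{c<..d}. epowr (tail_int d w x) (r / q) \<partial>profile_measure p r v c d)"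
proof -
  have sets: "{c} \<in> sets (\<mu> r)" "{c<..d} \<in> sets (\<mu> r)" using cd by (auto intro!: sets_\<mu>)
  have "(\<integral>\<^sup>+x\<in>{c..d}. ennreal (W x powr (r / q)) \<partial>\<mu> r)
      = (\<integral>\<^sup>+x. ennreal (W x powr (r / q)) * indicator {c} x + ennreal (W x powr (r / q)) * indicator {c<..d} x \<partial>\<mu> r)"
    using cd by (intro nn_integral_cong) (auto simp: indicator_def)
  also have "\<dots> = (\<integral>\<^sup>+x\<in>{c}. ennreal (W x powr (r / q)) \<partial>\<mu> r) + (\<integral>\<^sup>+x\<in>{c<..d}. ennreal (W x powr (r / q)) \<partial>\<mu> r)"
    by (intro nn_integral_add borel_measurable_times_ennreal W_powr_measurable r0 borel_measurable_indicator sets)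
  also have "(\<integral>\<^sup>+x\<in>{c}. ennreal (W x powr (r / q)) \<partial>\<mu> r) = ennreal (W c powr (r / q)) * emeasure (\<mu> r) {c}"
    using sets by (intro nn_integral_indicator_singleton)
  also have "emeasure (\<mu> r) {c} = ennreal (\<Phi> c powr r)"
    using emeasure_\<mu>_Icc[OF r0 endpoints_mem(1)] by simp
  finally have split: "(\<integral>\<^sup>+x\<in>{c..d}. ennreal (W x powr (r / q)) \<partial>\<mu> r) = ennreal (W c powr (r / q)) * ennreal (\<Phi> c powr r)
      + (\<integral>\<^sup>+x\<in>{c<..d}. ennreal (W x powr (r / q)) \<partial>\<mu> r)" .
  have sub: "{c<..d} \<subseteq> {c..d}" by auto
  show ?thesis
    unfolding profile_measure_eq[OF prof r0] tail_integral_eq[OF r0 sub] tail_integral_eq[OF r0 order_refl] split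
    using cd r0 q W_nonneg \<Phi>_nonneg[of c]
    by (simp add: prof tail_int_eq epowr_ennreal_pos)
qed

end

section \<open>The profile for p > 1\<close>

text \<open>
  The splitting lemma for the product of \<open>h v\<^sup>1\<^sup>/\<^sup>p\<close> and \<open>v\<^sup>-\<^sup>1\<^sup>/\<^sup>p\<close>, extended to infinite values. It holds
  pointwise even where \<open>v = \<infinity>\<close>, because then either \<open>h = 0\<close> or the last term is infinite.
\<close>
lemma young_weighted:
  fixes h v :: ennreal
  assumes p: "1 < p" and v: "0 < v" and a: "0 < \<alpha>"
  shows "h \<le> ennreal \<alpha> * epowr v (1 - conj_exp p) + ennreal (\<alpha> powr (1 - p)) * (epowr h p * v)"
proof (cases "h = 0")
  case False
  show ?thesis
  proof (cases "h = top \<or> v = top")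
    case True
    have "epowr h p \<noteq> 0" using False p by (cases h) (auto simp: epowr_ennreal_pos)
    moreover have "epowr h p = top" if "h = top" using that p by simp
    ultimately have "epowr h p * v = top" using True v by (auto simp: ennreal_mult_eq_top_iff)
    then show ?thesis using a by (simp add: ennreal_mult_top)
  next
    case fin: False
    then obtain y u where y: "h = ennreal y" "0 \<le> y" and u: "v = ennreal u" "0 \<le> u"
      by (cases h; cases v) auto
    have u0: "0 < u" using u v by simp
    have e: "(u powr (- 1 / p)) powr (p / (p - 1)) = u powr (1 - conj_exp p)"
    proof -
      have "- 1 / p * (p / (p - 1)) = 1 - conj_exp p" using p by (simp add: conj_exp_def field_simps)
      then show ?thesis by (simp only: powr_powr)
    qed
    have "y * u powr (1 / p) * u powr (- 1 / p)
        \<le> \<alpha> * (u powr (- 1 / p)) powr (p / (p - 1)) + \<alpha> powr (1 - p) * (y * u powr (1 / p)) powr p"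
      using y a by (intro young_splitting p) auto
    moreover have "y * u powr (1 / p) * u powr (- 1 / p) = y"
      using u0 by (simp add: powr_add[symmetric] mult.assoc)
    moreover have "(y * u powr (1 / p)) powr p = y powr p * u"
      using p u0 by (simp add: powr_mult powr_powr)
    ultimately have "y \<le> \<alpha> * u powr (1 - conj_exp p) + \<alpha> powr (1 - p) * (y powr p * u)"
      by (simp only: e)
    moreover have "ennreal \<alpha> * epowr v (1 - conj_exp p) + ennreal (\<alpha> powr (1 - p)) * (epowr h p * v)
        = ennreal (\<alpha> * u powr (1 - conj_exp p) + \<alpha> powr (1 - p) * (y powr p * u))"
      using a u u0 y p by (simp add: epowr_ennreal epowr_ennreal_pos ennreal_mult ennreal_plus)
    ultimately show ?thesis using y(1) by (simp only: ennreal_leI)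
  qed
qed simp

text \<open>
  With \<open>\<sigma> = v\<^sup>1\<^sup>-\<^sup>p\<^sup>'\<close>, bounded because \<open>v\<close> is bounded below, the profile is a power of the Lipschitz function
  \<open>s x = \<integral>\<^sub>c\<^sup>x \<sigma>\<close>, hence continuous, and \<open>F = \<Phi>\<close>. The extremal function is \<open>\<sigma> / s x\<close> on \<open>[c,x]\<close>.
\<close>
lemma exists_profile_p_gt_1:
  fixes c d :: real
  assumes p: "1 < p" and q: "0 < q" and cd: "c < d"
    and v_meas [measurable]: "v \<in> borel_measurable (lebesgue_on {c..d})" and reg: "regular_weight v c d"
    and w_meas: "w \<in> borel_measurable (lebesgue_on {c..d})"
    and w_fin: "(\<integral>\<^sup>+t. w t \<partial>lebesgue_on {c..d}) < \<infinity>"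
  shows "\<exists>F \<Phi>. hardy_profile p q c d v w F \<Phi> \<and> (\<forall>x\<in>{c..d}. profile p v c d x = ennreal (\<Phi> x))"
proof -
  let ?M = "lebesgue_on {c..d}"
  obtain \<delta> where \<delta>: "0 < \<delta>" "AE t in ?M. ennreal \<delta> \<le> v t"
    using reg unfolding regular_weight_def by blast
  define \<sigma> where "\<sigma> = (\<lambda>t. epowr (v t) (1 - conj_exp p))"
  define B where "B = \<delta> powr (1 - conj_exp p)"
  define s where "s = (\<lambda>x. enn2real (\<integral>\<^sup>+t. \<sigma> t * indicator {c..x} t \<partial>?M))"
  define F where "F = (\<lambda>x. s x powr (1 / conj_exp p))"
  have p': "1 < conj_exp p" using p by (simp add: conj_exp_def field_simps)
  have inv_p': "1 / conj_exp p = 1 - 1 / p" using p by (simp add: conj_exp_def field_simps)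
  have [measurable]: "\<sigma> \<in> borel_measurable ?M" unfolding \<sigma>_def by measurable
  have ind [measurable]: "(indicator {a..b} :: real \<Rightarrow> ennreal) \<in> borel_measurable ?M"
      "(indicator {a<..b} :: real \<Rightarrow> ennreal) \<in> borel_measurable ?M" for a b
    by (rule measurable_restrict_space1, rule borel_measurable_indicator, simp)+
  have \<sigma>_le: "AE t in ?M. \<sigma> t \<le> ennreal B"
    using \<delta>(2)
  proof eventually_elim
    case (elim t)
    show ?case
    proof (cases "v t")
      case (real u)
      then have "\<delta> \<le> u" using elim \<delta>(1) by (simp add: ennreal_le_iff)
      then have "u powr (1 - conj_exp p) \<le> B" unfolding B_def using \<delta>(1) p' by (intro powr_mono2') auto
      then show ?thesis using real \<open>\<delta> \<le> u\<close> \<delta>(1) by (simp add: \<sigma>_def epowr_ennreal ennreal_leI)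
    next
      case top
      then show ?thesis using p' by (simp add: \<sigma>_def epowr_def)
    qed
  qed
  have piece: "(\<integral>\<^sup>+t. \<sigma> t * indicator {a<..b} t \<partial>?M) \<le> ennreal (B * (b - a))" if "c \<le> a" "a \<le> b" "b \<le> d" for a b
  proof -
    have "(\<integral>\<^sup>+t. \<sigma> t * indicator {a<..b} t \<partial>?M) \<le> (\<integral>\<^sup>+t. ennreal B * indicator {a<..b} t \<partial>?M)"
      using \<sigma>_le by (intro nn_integral_mono_AE) (auto elim!: eventually_mono intro: mult_right_mono)
    also have "\<dots> = ennreal B * emeasure ?M {a<..b}"
      using that by (subst nn_integral_cmult_indicator) (auto simp: sets_restrict_space_iff)
    also have "emeasure ?M {a<..b} = ennreal (b - a)"
      using that by (subst emeasure_restrict_space) auto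
    finally show ?thesis using that by (simp add: B_def ennreal_mult)
  qed
  have c_null: "AE t in ?M. t \<noteq> c"
    using cd by (intro AE_I'[of "{c}"]) (auto simp: null_sets_restrict_space)
  have Icc_Ioc: "(\<integral>\<^sup>+t. f t * indicator {c..x} t \<partial>?M) = (\<integral>\<^sup>+t. f t * indicator {c<..x} t \<partial>?M)" for f :: "real \<Rightarrow> ennreal" and x
    using c_null by (intro nn_integral_cong_AE) (auto elim!: eventually_mono simp: indicator_def)
  have s_eq: "(\<integral>\<^sup>+t. \<sigma> t * indicator {c..x} t \<partial>?M) = ennreal (s x)" if "x \<in> {c..d}" for x
  proof -
    have "(\<integral>\<^sup>+t. \<sigma> t * indicator {c..x} t \<partial>?M) \<le> ennreal (B * (x - c))"
      using piece[of c x] that unfolding Icc_Ioc by auto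
    then have "(\<integral>\<^sup>+t. \<sigma> t * indicator {c..x} t \<partial>?M) < top" using ennreal_less_top by (rule le_less_trans)
    then show ?thesis unfolding s_def by (simp add: ennreal_enn2real_if)
  qed
  have s0: "0 \<le> s x" for x by (simp add: s_def)
  have s_mono: "s x \<le> s y" if "x \<in> {c..d}" "y \<in> {c..d}" "x \<le> y" for x y
  proof -
    have "ennreal (s x) \<le> ennreal (s y)"
      unfolding s_eq[OF that(1), symmetric] s_eq[OF that(2), symmetric]
      using that by (intro nn_integral_mono) (auto simp: indicator_def)
    then show ?thesis using s0 by simp
  qed
  have s_lip: "s y \<le> s x + B * (y - x)" if "x \<in> {c..d}" "y \<in> {c..d}" "x \<le> y" for x y
  proof -
    have "ennreal (s y) = (\<integral>\<^sup>+t. \<sigma> t * indicator {c..x} t + \<sigma> t * indicator {x<..y} t \<partial>?M)"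
      unfolding s_eq[OF that(2), symmetric] using that by (intro nn_integral_cong) (auto simp: indicator_def)
    also have "\<dots> = ennreal (s x) + (\<integral>\<^sup>+t. \<sigma> t * indicator {x<..y} t \<partial>?M)"
      unfolding s_eq[OF that(1), symmetric] by (rule nn_integral_add) measurable
    also have "\<dots> \<le> ennreal (s x) + ennreal (B * (y - x))"
      using piece[of x y] that by (intro add_left_mono) auto
    also have "\<dots> = ennreal (s x + B * (y - x))" using that s0 by (simp add: B_def ennreal_plus)
    finally show ?thesis using that s0[of x] by (subst (asm) ennreal_le_iff) (auto simp: B_def)
  qed
  have "B-lipschitz_on {c..d} s"
  proof (rule lipschitz_onI)
    fix x y assume xy: "x \<in> {c..d}" "y \<in> {c..d}"
    show "dist (s x) (s y) \<le> B * dist x y"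
      using s_mono[OF xy] s_lip[OF xy] s_mono[OF xy(2,1)] s_lip[OF xy(2,1)]
      by (cases "x \<le> y") (auto simp: dist_real_def)
  qed (simp add: B_def)
  then have "continuous_on {c..d} s" by (rule lipschitz_on_continuous_on)
  then have F_cont: "continuous_on {c..d} F"
    unfolding F_def using s0 p' by (intro continuous_on_powr') auto
  have F_mono: "F x \<le> F y" if "x \<in> {c..d}" "y \<in> {c..d}" "x \<le> y" for x y
    unfolding F_def using s_mono[OF that] s0 p' by (intro powr_mono2) auto
  have hp: "hardy_profile p q c d v w F F"
  proof
    show "1 \<le> p" using p by simp
    show "mono_on {c..d} F" using F_mono by (intro mono_onI) auto
    have "s c = 0"
      using piece[of c c] cd unfolding s_def Icc_Ioc by simp
    then show "F c = 0" by (simp add: F_def)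
    show "F x \<le> F y" if "c \<le> x" "x < y" "y \<le> d" for x y using that F_mono[of x y] by auto
    show "continuous (at_right x) F" if x: "c \<le> x" "x < d" for x
    proof -
      have "(F \<longlongrightarrow> F x) (at x within {c..d})" using F_cont x by (auto simp: continuous_on_def)
      moreover have "at_right x \<le> at x within {c..d}"
        using x by (subst at_within_Icc_at_right[symmetric, of x d]) (auto intro!: at_le)
      ultimately show ?thesis unfolding continuous_within by (rule tendsto_mono[rotated])
    qed
    show "F x \<le> k" if x: "c < x" "x \<le> d" and le: "\<And>y. c \<le> y \<Longrightarrow> y < x \<Longrightarrow> F y \<le> k" for x k
    proof (rule tendsto_upperbound)
      have "(F \<longlongrightarrow> F x) (at x within {c..d})" using F_cont x by (auto simp: continuous_on_def)
      moreover have "at_left x \<le> at x within {c..d}"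
        using x by (subst at_within_Icc_at_left[symmetric, of c x]) (auto intro!: at_le)
      ultimately show "(F \<longlongrightarrow> F x) (at_left x)" by (rule tendsto_mono[rotated])
      show "\<forall>\<^sub>F y in at_left x. F y \<le> k"
        unfolding eventually_at_left_field using x le by (intro exI[of _ c]) auto
    qed simp
    show "(\<integral>\<^sup>+t. h t * indicator {c..x} t \<partial>?M)
          \<le> ennreal (2 * F x * enn2real (\<integral>\<^sup>+t. epowr (h t) p * v t \<partial>?M) powr (1 / p))"
      if h [measurable]: "h \<in> borel_measurable ?M" and fin: "(\<integral>\<^sup>+t. epowr (h t) p * v t \<partial>?M) < \<infinity>" and x: "x \<in> {c..d}"
      for h x
    proof -
      define X where "X = enn2real (\<integral>\<^sup>+t. epowr (h t) p * v t \<partial>?M)"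
      have X: "(\<integral>\<^sup>+t. epowr (h t) p * v t \<partial>?M) = ennreal X" "0 \<le> X"
        using fin by (simp_all add: X_def ennreal_enn2real_if top.not_eq_extremum)
      have young: "(\<integral>\<^sup>+t. h t * indicator {c..x} t \<partial>?M) \<le> ennreal (\<alpha> * s x + \<alpha> powr (1 - p) * X)" if \<alpha>: "0 < \<alpha>" for \<alpha>
      proof -
        have "(\<integral>\<^sup>+t. h t * indicator {c..x} t \<partial>?M)
            \<le> (\<integral>\<^sup>+t. ennreal \<alpha> * (\<sigma> t * indicator {c..x} t) + ennreal (\<alpha> powr (1 - p)) * (epowr (h t) p * v t) \<partial>?M)"
        proof (intro nn_integral_mono_AE)
          show "AE t in ?M. h t * indicator {c..x} t
              \<le> ennreal \<alpha> * (\<sigma> t * indicator {c..x} t) + ennreal (\<alpha> powr (1 - p)) * (epowr (h t) p * v t)"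
            using \<delta>(2)
          proof eventually_elim
            case (elim t)
            have "0 < v t" using elim \<delta>(1) by (meson ennreal_less_zero_iff less_le_trans)
            then show ?case using young_weighted[OF p _ \<alpha>, of "v t" "h t"] by (auto simp: \<sigma>_def indicator_def)
          qed
        qed
        also have "\<dots> = ennreal \<alpha> * ennreal (s x) + ennreal (\<alpha> powr (1 - p)) * ennreal X"
          by (simp add: nn_integral_add nn_integral_cmult s_eq[OF x] X(1))
        also have "\<dots> = ennreal (\<alpha> * s x + \<alpha> powr (1 - p) * X)"
          using \<alpha> s0 X(2) by (simp add: ennreal_mult ennreal_plus)
        finally show ?thesis .
      qed
      then obtain Y where Y: "(\<integral>\<^sup>+t. h t * indicator {c..x} t \<partial>?M) = ennreal Y" "0 \<le> Y"
        using young[of 1] by (cases "\<integral>\<^sup>+t. h t * indicator {c..x} t \<partial>?M") (auto simp: top_unique)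
      \<comment> \<open>Either of \<open>s x\<close> and \<open>X\<close> may vanish; both are enlarged by \<open>\<epsilon>\<close> so that the balancing \<open>\<alpha>\<close> exists.\<close>
      have bound: "Y \<le> 2 * (s x + \<epsilon>) powr (1 - 1 / p) * (X + \<epsilon>) powr (1 / p)" if \<epsilon>: "0 < \<epsilon>" for \<epsilon>
      proof -
        define \<alpha> where "\<alpha> = ((X + \<epsilon>) / (s x + \<epsilon>)) powr (1 / p)"
        have pos: "0 < s x + \<epsilon>" "0 < X + \<epsilon>" using s0[of x] X(2) \<epsilon> by linarith+
        have \<alpha>: "0 < \<alpha>" using pos by (simp add: \<alpha>_def)
        have "Y \<le> \<alpha> * s x + \<alpha> powr (1 - p) * X"
          using young[OF \<alpha>] \<alpha> s0[of x] X(2) unfolding Y(1)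
          by (subst (asm) ennreal_le_iff) auto
        also have "\<dots> \<le> \<alpha> * (s x + \<epsilon>) + \<alpha> powr (1 - p) * (X + \<epsilon>)"
          using \<alpha> \<epsilon> by (intro add_mono mult_left_mono) auto
        also have "\<dots> = 2 * (X + \<epsilon>) powr (1 / p) * (s x + \<epsilon>) powr (1 - 1 / p)"
          unfolding \<alpha>_def using p pos by (intro balanced_splitting)
        finally show ?thesis by (simp add: mult_ac)
      qed
      have "((\<lambda>\<epsilon>. 2 * (s x + \<epsilon>) powr (1 - 1 / p) * (X + \<epsilon>) powr (1 / p))
          \<longlongrightarrow> 2 * (s x + 0) powr (1 - 1 / p) * (X + 0) powr (1 / p)) (at_right 0)"
        using p s0[of x] X(2)
        by (intro tendsto_intros tendsto_powr' tendsto_const) (auto simp: eventually_at_right_field intro!: exI[of _ 1])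
      moreover have "\<forall>\<^sub>F \<epsilon> in at_right 0. Y \<le> 2 * (s x + \<epsilon>) powr (1 - 1 / p) * (X + \<epsilon>) powr (1 / p)"
        unfolding eventually_at_right_field using bound by (intro exI[of _ 1]) auto
      ultimately have "Y \<le> 2 * (s x + 0) powr (1 - 1 / p) * (X + 0) powr (1 / p)"
        by (rule tendsto_lowerbound) simp
      then show ?thesis unfolding Y F_def inv_p' X_def[symmetric] by (intro ennreal_leI) simp
    qed
    show "\<exists>h\<in>borel_measurable ?M. 1 \<le> (\<integral>\<^sup>+t. h t * indicator {c..x} t \<partial>?M) \<and>
          (\<integral>\<^sup>+t. epowr (h t) p * v t \<partial>?M) \<le> ennreal (k powr - p)"
      if x: "x \<in> {c..d}" and k: "0 < k" "k < F x" for x k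
    proof -
      have "s x \<noteq> 0" using k by (auto simp: F_def)
      then have sx: "0 < s x" using s0[of x] by simp
      define h where "h = (\<lambda>t. ennreal (1 / s x) * (\<sigma> t * indicator {c..x} t))"
      have [measurable]: "h \<in> borel_measurable ?M" unfolding h_def by measurable
      have "(\<integral>\<^sup>+t. h t * indicator {c..x} t \<partial>?M) = (\<integral>\<^sup>+t. ennreal (1 / s x) * (\<sigma> t * indicator {c..x} t) \<partial>?M)"
        unfolding h_def by (intro nn_integral_cong) (simp add: indicator_def)
      also have "\<dots> = 1" using sx by (simp add: nn_integral_cmult s_eq[OF x] ennreal_mult[symmetric])
      finally have 1: "1 \<le> (\<integral>\<^sup>+t. h t * indicator {c..x} t \<partial>?M)" by simp
      have "(\<integral>\<^sup>+t. epowr (h t) p * v t \<partial>?M)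
          \<le> (\<integral>\<^sup>+t. ennreal ((1 / s x) powr p) * (\<sigma> t * indicator {c..x} t) \<partial>?M)"
      proof (intro nn_integral_mono_AE)
        show "AE t in ?M. epowr (h t) p * v t \<le> ennreal ((1 / s x) powr p) * (\<sigma> t * indicator {c..x} t)"
          using \<delta>(2)
        proof eventually_elim
          case (elim t)
          show ?case
          proof (cases "v t")
            case (real u)
            then have u: "0 < u" using elim \<delta>(1) by (simp add: ennreal_le_iff)
            have "(1 - conj_exp p) * p + 1 = 1 - conj_exp p" using p by (simp add: conj_exp_def field_simps)
            then have "u powr ((1 - conj_exp p) * p) * u = u powr (1 - conj_exp p)"
              using u powr_add[of u "(1 - conj_exp p) * p" 1] by simp
            then show ?thesis
              using real u sx p by (auto simp: h_def \<sigma>_def indicator_def epowr_ennreal epowr_ennreal_pos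
                  ennreal_mult[symmetric] powr_mult powr_powr powr_divide)
          next
            case top
            then have "\<sigma> t = 0" using p' by (simp add: \<sigma>_def epowr_def)
            then show ?thesis using p by (simp add: h_def)
          qed
        qed
      qed
      also have "\<dots> = ennreal ((1 / s x) powr p) * ennreal (s x)"
        by (simp add: nn_integral_cmult s_eq[OF x])
      also have "\<dots> = ennreal (F x powr - p)"
      proof -
        have "F x powr - p = s x powr ((1 - 1 / p) * - p)" unfolding F_def inv_p' powr_powr ..
        also have "(1 - 1 / p) * - p = 1 - p" using p by (simp add: field_simps)
        finally have "F x powr - p = s x / s x powr p" using sx by (simp add: powr_diff)
        then show ?thesis using sx by (simp add: ennreal_mult[symmetric] powr_divide)
      qed
      also have "\<dots> \<le> ennreal (k powr - p)" using k p by (intro ennreal_leI powr_mono2') auto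
      finally show ?thesis using 1 by (intro bexI[of _ h]) auto
    qed
  qed (use q cd v_meas w_meas w_fin in auto)
  have "profile p v c d x = ennreal (F x)" if x: "x \<in> {c..d}" for x
  proof -
    have "(\<integral>\<^sup>+t\<in>{c..x}. epowr (v t) (1 - conj_exp p) \<partial>lebesgue) = ennreal (s x)"
      unfolding s_eq[OF x, symmetric] \<sigma>_def using x by (intro set_nn_integral_lebesgue_on) auto
    then show ?thesis
      using p p' s0[of x] by (simp add: profile_def F_def epowr_ennreal_pos)
  qed
  then show ?thesis using hp by blast
qed

section \<open>The profile for p = 1\<close>

lemma inverse_ennreal_le_iff:
  fixes u :: ennreal assumes "0 < a"
  shows "inverse u \<le> ennreal a \<longleftrightarrow> ennreal (1 / a) \<le> u"
proof (cases u)
  case (real s)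
  show ?thesis
  proof (cases "s = 0")
    case True
    then show ?thesis using real assms by (simp add: top_unique ennreal_eq_0_iff)
  next
    case False
    then have "0 < s" using real by simp
    then have "inverse u = ennreal (inverse s)" "(inverse s \<le> a) = (1 / a \<le> s)"
      using real assms by (simp_all add: inverse_ennreal field_simps)
    then show ?thesis using real assms by (simp add: ennreal_le_iff)
  qed
qed simp

text \<open>
  The only property of the essential supremum used below; monotonicity, left continuity and
  boundedness of the profile become statements about null sets.
\<close>
lemma ess_profile_le_iff:
  assumes v: "v \<in> borel_measurable (lebesgue_on {c..d})" and x: "x \<le> d"
  shows "ess_profile v c x \<le> s \<longleftrightarrow> (AE t in lebesgue_on {c..d}. t \<in> {c<..<x} \<longrightarrow> 1 / v t \<le> s)"
proof -
  have sub: "{c<..<x} \<subseteq> {c..d}" using x by auto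
  have eq: "lebesgue_on {c<..<x} = restrict_space (lebesgue_on {c..d}) {c<..<x}"
    using sub by (simp add: restrict_restrict_space Int_absorb1)
  have meas: "(\<lambda>t. 1 / v t) \<in> borel_measurable (lebesgue_on {c<..<x})"
    unfolding eq by (intro measurable_restrict_space1 borel_measurable_divide_ennreal v borel_measurable_const)
  have "ess_profile v c x \<le> s \<longleftrightarrow> (AE t in lebesgue_on {c<..<x}. 1 / v t \<le> s)"
  proof
    assume "ess_profile v c x \<le> s"
    then show "AE t in lebesgue_on {c<..<x}. 1 / v t \<le> s"
      using esssup_AE[of "\<lambda>t. 1 / v t" "lebesgue_on {c<..<x}"] unfolding ess_profile_def
      by (auto elim!: eventually_mono)
  qed (simp add: ess_profile_def esssup_I[OF meas])
  also have "\<dots> \<longleftrightarrow> (AE t in lebesgue_on {c..d}. t \<in> {c<..<x} \<longrightarrow> 1 / v t \<le> s)"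
    unfolding eq using sub by (subst AE_restrict_space_iff) (auto simp: sets_restrict_space_iff)
  finally show ?thesis .
qed

text \<open>
  Here \<open>F\<close> is the essential supremum of \<open>1 / v\<close> over \<open>(c,x)\<close>, left-continuous because a union of
  countably many null sets is null, and \<open>\<Phi>\<close> is its right limit, which is an infimum by
  monotonicity. An extremal function for \<open>k < F x\<close> is the normalised indicator of the set of
  points in \<open>(c,x)\<close> where \<open>1 / v > k\<close>.
\<close>
lemma exists_profile_p_eq_1:
  fixes c d :: real
  assumes q: "0 < q" and cd: "c < d"
    and v_meas [measurable]: "v \<in> borel_measurable (lebesgue_on {c..d})" and reg: "regular_weight v c d"
    and w_meas: "w \<in> borel_measurable (lebesgue_on {c..d})"
    and w_fin: "(\<integral>\<^sup>+t. w t \<partial>lebesgue_on {c..d}) < \<infinity>"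
  shows "\<exists>F \<Phi>. hardy_profile 1 q c d v w F \<Phi> \<and> (\<forall>x\<in>{c..d}. profile 1 v c d x = ennreal (\<Phi> x))"
proof -
  let ?M = "lebesgue_on {c..d}"
  obtain \<delta> where \<delta>: "0 < \<delta>" "AE t in ?M. ennreal \<delta> \<le> v t"
    using reg unfolding regular_weight_def by blast
  define f where "f = ess_profile v c"
  define R where "R = (\<lambda>x. INF y\<in>{x<..d}. f y)"
  define F where "F = (\<lambda>x. enn2real (f x))"
  define \<Phi> where "\<Phi> = (\<lambda>x. if x < d then enn2real (R x) else F d)"
  have f_iff: "f x \<le> s \<longleftrightarrow> (AE t in ?M. t \<in> {c<..<x} \<longrightarrow> 1 / v t \<le> s)" if "x \<le> d" for x s
    unfolding f_def using ess_profile_le_iff[OF v_meas that] .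
  have f_AE: "AE t in ?M. t \<in> {c<..<x} \<longrightarrow> 1 / v t \<le> f x" if "x \<le> d" for x
    using f_iff[OF that, of "f x"] by simp
  have f_mono: "f x \<le> f y" if "x \<le> y" "y \<le> d" for x y
    using that f_AE[of y] f_iff[of x "f y"] by (auto elim!: eventually_mono)
  have f_fin: "f x \<le> ennreal (1 / \<delta>)" if "x \<le> d" for x
    unfolding f_iff[OF that] using \<delta>(2)
  proof eventually_elim
    case (elim t)
    then show ?case using inverse_ennreal_le_iff[of "1 / \<delta>" "v t"] \<delta>(1) by (simp add: divide_ennreal_def)
  qed
  have f_eq: "f x = ennreal (F x)" if "x \<le> d" for x
    using le_less_trans[OF f_fin[OF that] ennreal_less_top] by (simp add: F_def ennreal_enn2real_if)
  have F0: "0 \<le> F x" for x by (simp add: F_def)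
  have R_eq: "R x = ennreal (\<Phi> x)" if "x < d" for x
  proof -
    have "R x \<le> f d" unfolding R_def using that by (intro INF_lower) auto
    also have "\<dots> < top" using f_eq[of d] by simp
    finally show ?thesis using that by (simp add: \<Phi>_def ennreal_enn2real_if)
  qed
  have \<Phi>0: "0 \<le> \<Phi> x" for x by (simp add: \<Phi>_def F_def)
  have \<Phi>_le_F: "\<Phi> x \<le> F y" if "x < y" "y \<le> d" for x y
  proof -
    have "R x \<le> f y" unfolding R_def using that by (intro INF_lower) auto
    then show ?thesis using that R_eq[of x] f_eq[of y] F0[of y] by (simp add: ennreal_le_iff)
  qed
  have F_le_\<Phi>: "F x \<le> \<Phi> x" if "x \<le> d" for x
  proof (cases "x < d")
    case True
    have "f x \<le> R x" unfolding R_def by (intro INF_greatest f_mono) auto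
    then show ?thesis using True R_eq[of x] f_eq[of x] \<Phi>0[of x] by (simp add: ennreal_le_iff)
  qed (use that in \<open>simp add: \<Phi>_def\<close>)
  have R_less: "\<exists>y. x < y \<and> y \<le> d \<and> f y < s" if "R x < s" for x s
    using that unfolding R_def INF_less_iff by auto
  have hp: "hardy_profile 1 q c d v w F \<Phi>"
  proof
    show "mono_on {c..d} F"
    proof (rule mono_onI)
      fix x y assume "x \<in> {c..d}" "y \<in> {c..d}" "x \<le> y"
      then show "F x \<le> F y" using f_mono[of x y] F0[of y] by (simp add: f_eq ennreal_le_iff)
    qed
    have "f c \<le> 0" using cd by (subst f_iff) auto
    then show "F c = 0" by (simp add: F_def)
    show "F x \<le> \<Phi> x" if "x \<in> {c..d}" for x using F_le_\<Phi> that by simp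
    show "\<Phi> x \<le> F y" if "c \<le> x" "x < y" "y \<le> d" for x y using \<Phi>_le_F that by simp
    show "\<Phi> d = F d" by (simp add: \<Phi>_def)
    show "F x \<le> k" if x: "c < x" "x \<le> d" and le: "\<And>y. c \<le> y \<Longrightarrow> y < x \<Longrightarrow> F y \<le> k" for x k
    proof -
      have k0: "0 \<le> k" using le[of c] x F0[of c] by simp
      \<comment> \<open>Rational \<open>y\<close> suffice, so that only countably many null sets have to be united.\<close>
      have "AE t in ?M. \<forall>y\<in>\<rat> \<inter> {c<..<x}. t \<in> {c<..<y} \<longrightarrow> 1 / v t \<le> ennreal k"
      proof (subst AE_ball_countable)
        show "countable (\<rat> \<inter> {c<..<x})" using countable_rat by blast
        show "\<forall>y\<in>\<rat> \<inter> {c<..<x}. AE t in ?M. t \<in> {c<..<y} \<longrightarrow> 1 / v t \<le> ennreal k"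
        proof
          fix y assume y: "y \<in> \<rat> \<inter> {c<..<x}"
          then have "f y \<le> ennreal k" using le[of y] x k0 by (subst f_eq) (auto intro!: ennreal_leI)
          then show "AE t in ?M. t \<in> {c<..<y} \<longrightarrow> 1 / v t \<le> ennreal k" using f_iff[of y] x y by simp
        qed
      qed
      then have "AE t in ?M. t \<in> {c<..<x} \<longrightarrow> 1 / v t \<le> ennreal k"
      proof eventually_elim
        case (elim t)
        show ?case
        proof
          assume t: "t \<in> {c<..<x}"
          then obtain y where "y \<in> \<rat>" "t < y" "y < x" using Rats_dense_in_real[of t x] by auto
          then show "1 / v t \<le> ennreal k" using elim t by auto
        qed
      qed
      then have "f x \<le> ennreal k" using f_iff x by simp
      then show ?thesis using f_eq[of x] x k0 by (simp add: ennreal_le_iff)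
    qed
    show "continuous (at_right x) \<Phi>" if x: "c \<le> x" "x < d" for x
      unfolding continuous_within
    proof (rule order_tendstoI)
      have mono: "\<Phi> x \<le> \<Phi> y" if "x < y" "y < d" for y using \<Phi>_le_F[of x y] F_le_\<Phi>[of y] that by simp
      show "\<forall>\<^sub>F y in at_right x. k < \<Phi> y" if "k < \<Phi> x" for k
        unfolding eventually_at_right_field using that mono x by (intro exI[of _ d]) (auto intro: less_le_trans)
      show "\<forall>\<^sub>F y in at_right x. \<Phi> y < k" if k: "\<Phi> x < k" for k
      proof -
        have "R x < ennreal k" using R_eq[of x] x k \<Phi>0[of x] by (simp add: ennreal_lessI)
        then obtain y where y: "x < y" "y \<le> d" "f y < ennreal k" using R_less by blast
        then have "F y < k" using f_eq[of y] F0[of y] by (simp add: ennreal_less_iff)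
        then show ?thesis
          unfolding eventually_at_right_field using y \<Phi>_le_F by (intro exI[of _ y]) (auto intro: le_less_trans)
      qed
    qed
    show "(\<integral>\<^sup>+t. h t * indicator {c..x} t \<partial>?M)
          \<le> ennreal (2 * F x * enn2real (\<integral>\<^sup>+t. epowr (h t) 1 * v t \<partial>?M) powr (1 / 1))"
      if h [measurable]: "h \<in> borel_measurable ?M" and fin: "(\<integral>\<^sup>+t. epowr (h t) 1 * v t \<partial>?M) < \<infinity>" and x: "x \<in> {c..d}"
      for h x
    proof -
      define X where "X = enn2real (\<integral>\<^sup>+t. h t * v t \<partial>?M)"
      have X: "(\<integral>\<^sup>+t. h t * v t \<partial>?M) = ennreal X" "0 \<le> X"
        using fin by (simp_all add: X_def ennreal_enn2real_if top.not_eq_extremum)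
      have "AE t in ?M. h t * v t \<noteq> \<infinity>" using fin by (intro nn_integral_PInf_AE) auto
      moreover have "AE t in ?M. t \<notin> {c, x}"
        using x by (intro AE_I'[of "{c, x}"]) (auto simp: null_sets_restrict_space)
      moreover have "AE t in ?M. t \<in> {c<..<x} \<longrightarrow> 1 / v t \<le> f x" using f_AE x by simp
      ultimately have "AE t in ?M. h t * indicator {c..x} t \<le> ennreal (F x) * (h t * v t)"
        using \<delta>(2)
      proof eventually_elim
        case (elim t)
        show ?case
        proof (cases "t \<in> {c..x} \<and> h t \<noteq> 0")
          case True
          then have le: "inverse (v t) \<le> ennreal (F x)" using elim f_eq[of x] x by (auto simp: divide_ennreal_def)
          have v0: "v t \<noteq> 0" using elim(4) \<delta>(1) by (auto simp: ennreal_eq_0_iff)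
          have vtop: "v t \<noteq> top" using elim(1) True by (auto simp: ennreal_mult_top)
          have "inverse (v t) * v t = 1"
            using ennreal_divide_self[OF v0] vtop by (simp add: divide_ennreal_def less_top mult.commute)
          then have "h t * 1 = h t * (inverse (v t) * v t)" by simp
          also have "\<dots> \<le> h t * (ennreal (F x) * v t)" using le by (intro mult_left_mono mult_right_mono) auto
          finally show ?thesis using True by (simp add: mult_ac)
        qed auto
      qed
      then have "(\<integral>\<^sup>+t. h t * indicator {c..x} t \<partial>?M) \<le> (\<integral>\<^sup>+t. ennreal (F x) * (h t * v t) \<partial>?M)"
        by (rule nn_integral_mono_AE)
      also have "\<dots> = ennreal (F x * X)" using F0 X(2) by (simp add: nn_integral_cmult X(1) ennreal_mult)
      also have "\<dots> \<le> ennreal (2 * F x * X)" using F0[of x] X(2) by (intro ennreal_leI) simp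
      finally show ?thesis using X(2) by (simp add: X_def)
    qed
    show "\<exists>h\<in>borel_measurable ?M. 1 \<le> (\<integral>\<^sup>+t. h t * indicator {c..x} t \<partial>?M) \<and>
          (\<integral>\<^sup>+t. epowr (h t) 1 * v t \<partial>?M) \<le> ennreal (k powr - 1)"
      if x: "x \<in> {c..d}" and k: "0 < k" "k < F x" for x k
    proof -
      define S where "S = {t \<in> space ?M. t \<in> {c<..<x} \<and> ennreal k < 1 / v t}"
      have [measurable]: "{c<..<x} \<in> sets ?M" using x by (auto simp: sets_restrict_space_iff)
      have S_meas [measurable]: "S \<in> sets ?M" unfolding S_def by measurable
      have "\<not> f x \<le> ennreal k" using k f_eq[of x] x by (simp add: ennreal_le_iff)
      then have "\<not> (AE t in ?M. t \<in> {c<..<x} \<longrightarrow> 1 / v t \<le> ennreal k)" using f_iff[of x] x by simp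
      moreover have "{t \<in> space ?M. \<not> (t \<in> {c<..<x} \<longrightarrow> 1 / v t \<le> ennreal k)} = S"
        unfolding S_def by auto
      ultimately have pos: "emeasure ?M S \<noteq> 0"
        using AE_iff_measurable[OF S_meas, of "\<lambda>t. t \<in> {c<..<x} \<longrightarrow> 1 / v t \<le> ennreal k"] by simp
      have "emeasure ?M S \<le> emeasure ?M {c..d}" by (intro emeasure_mono) (auto simp: S_def)
      also have "\<dots> < top" using cd by (simp add: emeasure_restrict_space)
      finally obtain \<beta> where \<beta>: "emeasure ?M S = ennreal \<beta>" "0 \<le> \<beta>" by (cases "emeasure ?M S") auto
      then have \<beta>0: "0 < \<beta>" using pos by (cases "\<beta> = 0") auto
      define h where "h = (\<lambda>t. ennreal (1 / \<beta>) * indicator S t)"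
      have hm: "h \<in> borel_measurable ?M" unfolding h_def by measurable
      have int: "(\<integral>\<^sup>+t. h t \<partial>?M) = 1"
        unfolding h_def using \<beta>0 by (simp add: nn_integral_cmult_indicator \<beta>(1) ennreal_mult[symmetric])
      have "(\<integral>\<^sup>+t. h t * indicator {c..x} t \<partial>?M) = (\<integral>\<^sup>+t. h t \<partial>?M)"
        by (intro nn_integral_cong) (auto simp: h_def S_def indicator_def)
      then have 1: "1 \<le> (\<integral>\<^sup>+t. h t * indicator {c..x} t \<partial>?M)" using int by simp
      have "(\<integral>\<^sup>+t. epowr (h t) 1 * v t \<partial>?M) \<le> (\<integral>\<^sup>+t. ennreal (1 / k) * h t \<partial>?M)"
      proof (intro nn_integral_mono)
        fix t
        show "epowr (h t) 1 * v t \<le> ennreal (1 / k) * h t"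
        proof (cases "t \<in> S")
          case True
          then have "ennreal k < inverse (v t)" by (simp add: S_def divide_ennreal_def)
          then have "\<not> ennreal (1 / k) \<le> v t" using inverse_ennreal_le_iff[OF k(1), of "v t"] by auto
          then show ?thesis by (simp add: mult.commute mult_left_mono)
        qed (simp add: h_def)
      qed
      also have "\<dots> = ennreal (1 / k)" using hm int by (simp add: nn_integral_cmult)
      also have "1 / k = k powr - 1" using k by (simp add: powr_minus_divide)
      finally show ?thesis using 1 hm by (intro bexI[of _ h]) auto
    qed
  qed (use q cd v_meas w_meas w_fin in auto)
  have lim: "(f \<longlongrightarrow> R x) (at_right x)" if x: "x < d" for x
  proof (rule order_tendstoI)
    show "\<forall>\<^sub>F y in at_right x. s < f y" if s: "s < R x" for s
      unfolding eventually_at_right_field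
    proof (intro exI[of _ d] conjI allI impI x)
      fix y assume "x < y" "y < d"
      then have "R x \<le> f y" unfolding R_def by (intro INF_lower) auto
      then show "s < f y" using s by simp
    qed
    show "\<forall>\<^sub>F y in at_right x. f y < s" if s: "R x < s" for s
    proof -
      obtain y where y: "x < y" "y \<le> d" "f y < s" using R_less[OF s] by blast
      have "f u < s" if "u < y" for u using f_mono[of u y] y that by (auto intro: le_less_trans)
      then show ?thesis unfolding eventually_at_right_field using y by (intro exI[of _ y]) auto
    qed
  qed
  have "profile 1 v c d x = ennreal (\<Phi> x)" if x: "x \<in> {c..d}" for x
  proof (cases "x < d")
    case True
    have "Lim (at_right x) f = R x" by (rule tendsto_Lim[OF _ lim[OF True]]) simp
    then show ?thesis using True R_eq[OF True] by (simp add: profile_def f_def)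
  next
    case False
    then show ?thesis using x f_eq[of d] by (simp add: profile_def f_def \<Phi>_def)
  qed
  then show ?thesis using hp by blast
qed

section \<open>The equivalence theorem\<close>

theorem theorem3p4:
  fixes p q :: real
  assumes "1 \<le> p" and "0 < q"
  shows "\<exists>k K :: real. 0 < k \<and> k \<le> K \<and>
    (\<forall>(c::real) (d::real) (v :: real \<Rightarrow> ennreal) (w :: real \<Rightarrow> ennreal).
       c < d \<longrightarrow>
       v \<in> borel_measurable (lebesgue_on {c..d}) \<longrightarrow>
       regular_weight v c d \<longrightarrow>
       w \<in> borel_measurable (lebesgue_on {c..d}) \<longrightarrow>
       (\<integral>\<^sup>+t\<in>{c..d}. w t \<partial>lebesgue) < \<infinity> \<longrightarrow>
       (p \<le> q \<longrightarrow>
          ennreal k * hardy_A_le p q v w c d \<le> opt_const p q v w c d \<and>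
          opt_const p q v w c d \<le> ennreal K * hardy_A_le p q v w c d) \<and>
       (\<forall>r::real. q < p \<and> 1 / r = 1 / q - 1 / p \<longrightarrow>
          ennreal k * hardy_A_lt p q r v w c d \<le> opt_const p q v w c d \<and>
          opt_const p q v w c d \<le> ennreal K * hardy_A_lt p q r v w c d \<and>
          (p = 1 \<longrightarrow>
             (\<integral>\<^sup>+x\<in>{c..d}. epowr (tail_int d w x) (r / q) \<partial>profile_measure p r v c d) =
             epowr (tail_int d w c) (r / q) * epowr (profile 1 v c d c) r +
             (\<integral>\<^sup>+x\<in>{c<..d}. epowr (tail_int d w x) (r / q) \<partial>profile_measure p r v c d))))"
proof -
  \<comment> \<open>The exponent \<open>r\<close> is determined by \<open>p\<close> and \<open>q\<close>, so \<open>K2\<close> depends on these only.\<close>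
  define r0 where "r0 = 1 / (1 / q - 1 / p)"
  define K1 where "K1 = 4 * (2 * 4 powr p) powr (1 / p)"
  define K2 where "K2 = 4 * 2 powr (1 / q) * (2 * 4 powr p) powr (1 / p) * (1 / (1 - 4 powr - r0)) powr (1 / r0)"
  define K3 where "K3 = 4 * 2 powr (1 / q) * (2 * (1 - 2 powr - q) powr (- 1 / q))"
  have K3: "0 < K3" using powr_less_mono[of "- q" 0 2] assms by (simp add: K3_def)
  define k where "k = min 1 (1 / K3)"
  define K where "K = max 1 (max K1 K2)"
  have k: "0 < k" "k \<le> 1" "k * K3 \<le> 1" using K3 by (auto simp: k_def min_def field_simps)
  have K: "1 \<le> K" "K1 \<le> K" "K2 \<le> K" by (auto simp: K_def)
  show ?thesis
  proof (rule exI[of _ k], rule exI[of _ K], intro conjI allI impI)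
    show "0 < k" "k \<le> K" using k K by auto
  next
    fix c d :: real and v w :: "real \<Rightarrow> ennreal"
    assume cd: "c < d" and v: "v \<in> borel_measurable (lebesgue_on {c..d})" and reg: "regular_weight v c d"
      and w: "w \<in> borel_measurable (lebesgue_on {c..d})" and w_fin: "(\<integral>\<^sup>+t\<in>{c..d}. w t \<partial>lebesgue) < \<infinity>"
    have "(\<integral>\<^sup>+t. w t \<partial>lebesgue_on {c..d}) = (\<integral>\<^sup>+t\<in>{c..d}. w t \<partial>lebesgue)"
      by (subst nn_integral_restrict_space) auto
    then have w_fin': "(\<integral>\<^sup>+t. w t \<partial>lebesgue_on {c..d}) < \<infinity>" using w_fin by simp
    have "\<exists>F \<Phi>. hardy_profile p q c d v w F \<Phi> \<and> (\<forall>x\<in>{c..d}. profile p v c d x = ennreal (\<Phi> x))"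
    proof (cases "p = 1")
      case True
      then show ?thesis using exists_profile_p_eq_1[OF assms(2) cd v reg w w_fin'] by simp
    next
      case False
      then show ?thesis using exists_profile_p_gt_1[OF _ assms(2) cd v reg w w_fin', of p] assms(1) by simp
    qed
    then obtain F \<Phi> where hp: "hardy_profile p q c d v w F \<Phi>"
      and prof: "\<forall>x\<in>{c..d}. profile p v c d x = ennreal (\<Phi> x)" by blast
    interpret hardy_profile p q c d v w F \<Phi> by (rule hp)
    {
      assume pq: "p \<le> q"
      have "ennreal k * hardy_A_le p q v w c d \<le> 1 * hardy_A_le p q v w c d"
        using k by (intro mult_right_mono) auto
      then show "ennreal k * hardy_A_le p q v w c d \<le> opt_const p q v w c d"
        using hardy_A_le_equivalence(1)[OF prof pq] by simp
      have "opt_const p q v w c d \<le> ennreal K1 * hardy_A_le p q v w c d"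
        using hardy_A_le_equivalence(2)[OF prof pq] by (simp add: K1_def)
      also have "\<dots> \<le> ennreal K * hardy_A_le p q v w c d" using K by (intro mult_right_mono ennreal_leI) auto
      finally show "opt_const p q v w c d \<le> ennreal K * hardy_A_le p q v w c d" .
    next
      fix r :: real assume "q < p \<and> 1 / r = 1 / q - 1 / p"
      then have qp: "q < p" and r: "1 / r = 1 / q - 1 / p" by auto
      have r_pos: "0 < r" by (rule exponent_gap_pos[OF assms(2) qp r])
      have "r0 = r" unfolding r0_def r[symmetric] by simp
      note lt = hardy_A_lt_equivalence[OF prof qp r, folded \<open>r0 = r\<close>, folded K2_def K3_def, unfolded \<open>r0 = r\<close>]
      have "ennreal k * hardy_A_lt p q r v w c d \<le> ennreal k * (ennreal K3 * opt_const p q v w c d)"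
        using lt(1) by (intro mult_left_mono) auto
      also have "\<dots> = ennreal (k * K3) * opt_const p q v w c d"
        using k K3 by (simp add: ennreal_mult mult.assoc)
      also have "\<dots> \<le> ennreal 1 * opt_const p q v w c d"
        using k by (intro mult_right_mono ennreal_leI) auto
      finally show "ennreal k * hardy_A_lt p q r v w c d \<le> opt_const p q v w c d" by simp
      have "opt_const p q v w c d \<le> ennreal K2 * hardy_A_lt p q r v w c d" by (rule lt(2))
      also have "\<dots> \<le> ennreal K * hardy_A_lt p q r v w c d" using K by (intro mult_right_mono ennreal_leI) auto
      finally show "opt_const p q v w c d \<le> ennreal K * hardy_A_lt p q r v w c d" .
      show "(\<integral>\<^sup>+x\<in>{c..d}. epowr (tail_int d w x) (r / q) \<partial>profile_measure p r v c d) =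
             epowr (tail_int d w c) (r / q) * epowr (profile 1 v c d c) r +
             (\<integral>\<^sup>+x\<in>{c<..d}. epowr (tail_int d w x) (r / q) \<partial>profile_measure p r v c d)" if "p = 1"
        using atom_at_left_endpoint[OF prof r_pos] that by simp
    }
  qed
qed

end
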